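(* Let $q$ be a prime power with $q\equiv 1 \pmod 3$ and let $n=3(q+1)$. Let $\mathfrak X_n$ be the rank 6 association scheme of 2-orbits of $PSL(2,q)$ acting on the set $\Omega_n$ of one-third quasi-projective points, let $Pre_n$ be the pregraph obtained from $\mathfrak X_n$ by selecting an arbitrary fiber as island, and let $J_{n,0}$ be its rank 5 merging obtained by the switching $Sw_0$. Then $J_{n,0}$ is a proper Jordan scheme of order $n$.
   Context: Relations on a finite set are identified with their 0/1 adjacency matrices. An association scheme (AS) on a finite set $\Omega$ is a partition of $\Omega^2$ into nonempty relations, one of which is the identity relation, closed under transposition, whose adjacency matrices span a matrix algebra (closed under the usual product); it may be non-symmetric and non-commutative. A Jordan scheme on $\Omega$ is a partition of $\Omega^2$ into nonempty symmetric relations, one of which is the identity relation, such that the real linear span of the adjacency matrices is closed under the Jordan product $A*B=\frac12(AB+BA)$; its order is $|\Omega|$ and its rank is the number of relations. The symmetrization of an AS is obtained by replacing each relation $R$ by $R\cup R^T$. A Jordan scheme is non-proper if it is the symmetrization of some AS, and proper otherwise. Setting: let $F=\mathbb F_q$, $q=3l+1$, and let $\mathbb Z_l$ denote the subgroup of order $l=(q-1)/3$ of $F^*$. On $F^2\setminus\{0\}$ put $\vec p'\sim\vec p''$ iff $\vec p''=\lambda\vec p'$ for some $\lambda\in\mathbb Z_l$. The equivalence classes are the one-third quasi-projective points (ot-points); $\Omega_n$ is the set of all of them, $|\Omega_n|=3(q+1)=n$. $SL(2,q)$ acts on $\Omega_n$ by matrix multiplication, inducing an action of $PSL(2,q)$.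 Its 2-orbits (orbits on $\Omega_n^2$) are three relations $R_0=\mathrm{Id},R_1,R_2$ of valency 1 (pairs of collinear ot-points whose representatives satisfy $\vec p''=\lambda\vec p'$ with $\lambda$ in a given coset of $\mathbb Z_l$ in $F^*$) and three relations $\Delta_0,\Delta_1,\Delta_2$ of valency $q$ (pairs with $\det(\vec p',\vec p'')$ in a given coset of $\mathbb Z_l$ in $F^*$). The relation $R_0\cup R_1\cup R_2$ is an equivalence relation whose $q+1$ classes, of size 3, are called fibers. Fix a fiber (the island); the rest of $\Omega_n$ is the continent. $T_i$ is the restriction of $\Delta_i$ to the continent, and the bridge $Br_i$ is the set of pairs of $\Delta_i$ (in both directions) with one entry on the island and the other on the continent. The pregraph $Pre_n$ is the rank 10 color graph on $\Omega_n$ with relations: the identity relations on the island and on the continent, the restrictions of $R_1\cup R_2$ to the island and to the continent, $T_0,T_1,T_2$, and $Br_0,Br_1,Br_2$. The color graph $J_{n,0}$ has the five relations $\mathrm{Id}$, $R_1\cup R_2$, $\Delta_0=T_0\cup Br_0$, $T_1\cup Br_2$, $T_2\cup Br_1$. *)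

theory Defs
  imports "HOL-Analysis.Analysis" "HOL-Library.Disjoint_Sets" "HOL-Number_Theory.Prime_Powers"
begin

section \<open>Association schemes and Jordan schemes\<close>

text \<open>
  Relations on a subset \<open>\<Omega>\<close> of a finite type are represented by matrices indexed by the whole
  type. Entries outside \<open>\<Omega> \<times> \<Omega>\<close> vanish, so that the product of two such matrices
  is the product of the matrices indexed by \<open>\<Omega>\<close>, padded with zeros.
\<close>

definition adj_mat :: "('b::finite \<times> 'b) set \<Rightarrow> real^'b^'b" where
  "adj_mat S = (\<chi> x y. of_bool ((x, y) \<in> S))"

definition jordan_prod :: "real^'b::finite^'b \<Rightarrow> real^'b^'b \<Rightarrow> real^'b^'b" where
  "jordan_prod A B = (1/2) *\<^sub>R (A ** B + B ** A)"

definition association_scheme :: "'b::finite set \<Rightarrow> ('b \<times> 'b) set set \<Rightarrow> bool" where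
  "association_scheme \<Omega> \<S> \<longleftrightarrow>
     partition_on (\<Omega> \<times> \<Omega>) \<S> \<and> Id_on \<Omega> \<in> \<S> \<and> (\<forall>S\<in>\<S>. S\<inverse> \<in> \<S>) \<and>
     (\<forall>A \<in> span (adj_mat ` \<S>). \<forall>B \<in> span (adj_mat ` \<S>). A ** B \<in> span (adj_mat ` \<S>))"

definition jordan_scheme :: "'b::finite set \<Rightarrow> ('b \<times> 'b) set set \<Rightarrow> bool" where
  "jordan_scheme \<Omega> \<S> \<longleftrightarrow>
     partition_on (\<Omega> \<times> \<Omega>) \<S> \<and> Id_on \<Omega> \<in> \<S> \<and> (\<forall>S\<in>\<S>. sym S) \<and>
     (\<forall>A \<in> span (adj_mat ` \<S>). \<forall>B \<in> span (adj_mat ` \<S>).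
        jordan_prod A B \<in> span (adj_mat ` \<S>))"

definition symmetrization :: "('b \<times> 'b) set set \<Rightarrow> ('b \<times> 'b) set set" where
  "symmetrization \<S> = (\<lambda>S. S \<union> S\<inverse>) ` \<S>"

definition proper_jordan_scheme :: "'b::finite set \<Rightarrow> ('b \<times> 'b) set set \<Rightarrow> bool" where
  "proper_jordan_scheme \<Omega> \<S> \<longleftrightarrow>
     jordan_scheme \<Omega> \<S> \<and> \<not> (\<exists>\<A>. association_scheme \<Omega> \<A> \<and> \<S> = symmetrization \<A>)"


section \<open>One-third quasi-projective points\<close>

definition mult_subgroup :: "'a::field set \<Rightarrow> bool" where
  "mult_subgroup Z \<longleftrightarrow>
     0 \<notin> Z \<and> 1 \<in> Z \<and> (\<forall>x\<in>Z. \<forall>y\<in>Z. x * y \<in> Z) \<and> (\<forall>x\<in>Z. inverse x \<in> Z)"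

definition mult_cosets :: "'a::field set \<Rightarrow> 'a set set" where
  "mult_cosets Z = {(\<lambda>z. c * z) ` Z | c. c \<noteq> 0}"

definition ot_rel :: "'a::field set \<Rightarrow> ('a^2) rel" where
  "ot_rel Z = {(p, r). p \<noteq> 0 \<and> r \<noteq> 0 \<and> (\<exists>c\<in>Z. r = c *s p)}"

definition ot_points :: "'a::field set \<Rightarrow> ('a^2) set set" where
  "ot_points Z = (UNIV - {0}) // ot_rel Z"

text \<open>
  The permutations of the ot-points induced by \<open>SL(2,q)\<close>. When \<open>-1 \<in> Z\<close>, which is the case for
  the subgroup \<open>Z\<close> of index 3, the kernel of the action is \<open>{I, -I}\<close>, and so these permutations
  form the group \<open>PSL(2,q)\<close> in its action on the ot-points.
\<close>

definition psl2_perms :: "(('a::field^2) set \<Rightarrow> ('a^2) set) set" where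
  "psl2_perms = (\<lambda>A P. (\<lambda>p. A *v p) ` P) ` {A :: 'a^2^2. det A = 1}"

definition two_orbits :: "('b \<Rightarrow> 'b) set \<Rightarrow> 'b set \<Rightarrow> ('b \<times> 'b) set set" where
  "two_orbits G \<Omega> = {(\<lambda>g. (g x, g y)) ` G | x y. x \<in> \<Omega> \<and> y \<in> \<Omega>}"

abbreviation ot_scheme :: "'a::field set \<Rightarrow> (('a^2) set \<times> ('a^2) set) set set" where
  "ot_scheme Z \<equiv> two_orbits psl2_perms (ot_points Z)"

definition ot_R :: "'a::field set \<Rightarrow> 'a set \<Rightarrow> (('a^2) set \<times> ('a^2) set) set" where
  "ot_R Z c = {(P, Q). P \<in> ot_points Z \<and> Q \<in> ot_points Z \<and>
                 (\<exists>p\<in>P. \<exists>r\<in>Q. \<exists>k\<in>c. r = k *s p)}"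

definition ot_Delta :: "'a::field set \<Rightarrow> 'a set \<Rightarrow> (('a^2) set \<times> ('a^2) set) set" where
  "ot_Delta Z c = {(P, Q). P \<in> ot_points Z \<and> Q \<in> ot_points Z \<and>
                     (\<exists>p\<in>P. \<exists>r\<in>Q. det (vector [p, r] :: 'a^2^2) \<in> c)}"

text \<open>
  An admissible naming of the 2-orbits. The only constraint on the order of the cosets is that
  \<open>R 0\<close> is the identity; in particular any of the three cosets may be the one that defines
  \<open>D 0\<close>. The first conjunct follows from the others when \<open>Z\<close> is a subgroup, see
  \<open>ot_scheme_eq\<close> and \<open>ot_labellingI\<close> below.
\<close>

definition ot_labelling ::
  "'a::field set \<Rightarrow> (nat \<Rightarrow> (('a^2) set \<times> ('a^2) set) set) \<Rightarrow>
     (nat \<Rightarrow> (('a^2) set \<times> ('a^2) set) set) \<Rightarrow> bool" where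
  "ot_labelling Z R D \<longleftrightarrow>
     ot_scheme Z = R ` {0, 1, 2} \<union> D ` {0, 1, 2} \<and>
     (\<exists>K. bij_betw K {0, 1, 2::nat} (mult_cosets Z) \<and> K 0 = Z \<and>
          (\<forall>i\<in>{0, 1, 2}. R i = ot_R Z (K i))) \<and>
     (\<exists>C. bij_betw C {0, 1, 2::nat} (mult_cosets Z) \<and>
          (\<forall>i\<in>{0, 1, 2}. D i = ot_Delta Z (C i)))"


section \<open>Pregraph and switching\<close>

definition continent_part :: "'b set \<Rightarrow> 'b set \<Rightarrow> ('b \<times> 'b) set \<Rightarrow> ('b \<times> 'b) set" where
  "continent_part \<Omega> I S = S \<inter> (\<Omega> - I) \<times> (\<Omega> - I)"

definition bridge_part :: "'b set \<Rightarrow> 'b set \<Rightarrow> ('b \<times> 'b) set \<Rightarrow> ('b \<times> 'b) set" where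
  "bridge_part \<Omega> I S = S \<inter> (I \<times> (\<Omega> - I) \<union> (\<Omega> - I) \<times> I)"

definition pregraph ::
  "'b set \<Rightarrow> (nat \<Rightarrow> ('b \<times> 'b) set) \<Rightarrow> (nat \<Rightarrow> ('b \<times> 'b) set) \<Rightarrow> 'b set \<Rightarrow> ('b \<times> 'b) set set" where
  "pregraph \<Omega> R D I =
     {Id_on I, Id_on (\<Omega> - I), (R 1 \<union> R 2) \<inter> I \<times> I, continent_part \<Omega> I (R 1 \<union> R 2),
      continent_part \<Omega> I (D 0), continent_part \<Omega> I (D 1), continent_part \<Omega> I (D 2),
      bridge_part \<Omega> I (D 0), bridge_part \<Omega> I (D 1), bridge_part \<Omega> I (D 2)}"

definition switching_0 ::
  "'b set \<Rightarrow> (nat \<Rightarrow> ('b \<times> 'b) set) \<Rightarrow> (nat \<Rightarrow> ('b \<times> 'b) set) \<Rightarrow> 'b set \<Rightarrow> ('b \<times> 'b) set set" where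
  "switching_0 \<Omega> R D I =
     {Id_on \<Omega>, R 1 \<union> R 2,
      continent_part \<Omega> I (D 0) \<union> bridge_part \<Omega> I (D 0),
      continent_part \<Omega> I (D 1) \<union> bridge_part \<Omega> I (D 2),
      continent_part \<Omega> I (D 2) \<union> bridge_part \<Omega> I (D 1)}"


section \<open>The 2-orbits in coordinates\<close>

lemma det_rows_2: "det (vector [p, r] :: 'a::field^2^2) = p$1 * r$2 - p$2 * r$1"
  by (simp add: det_2 algebra_simps)

lemma mult_vec_2:
  "(A *v p)$1 = A$1$1 * p$1 + A$1$2 * p$2"
  "(A *v p)$2 = A$2$1 * p$1 + A$2$2 * p$2"
  for A :: "'a::field^2^2"
  by (simp_all add: matrix_vector_mult_def sum_2)

lemma det_rows_mult:
  "det (vector [A *v p, A *v r] :: 'a::field^2^2) = det A * det (vector [p, r] :: 'a^2^2)"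
  by (simp add: det_rows_2 det_2 mult_vec_2 algebra_simps)

lemma sl2_transitive_det:
  fixes p r p' r' :: "'a::field^2"
  assumes "det (vector [p, r] :: 'a^2^2) = det (vector [p', r'] :: 'a^2^2)"
    and "det (vector [p, r] :: 'a^2^2) \<noteq> 0"
  shows "\<exists>A :: 'a^2^2. det A = 1 \<and> A *v p = p' \<and> A *v r = r'"
proof -
  define d where "d = p$1 * r$2 - p$2 * r$1"
  have d0: "d \<noteq> 0" and d': "d = p'$1 * r'$2 - p'$2 * r'$1"
    using assms by (simp_all add: det_rows_2 d_def)
  define A :: "'a^2^2" where
    "A = vector [vector [(p'$1 * r$2 - r'$1 * p$2) / d, (r'$1 * p$1 - p'$1 * r$1) / d],
                 vector [(p'$2 * r$2 - r'$2 * p$2) / d, (r'$2 * p$1 - p'$2 * r$1) / d]]"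
  have e: "x * d / d = x" for x using d0 by simp
  have p: "A *v p = p'"
  proof -
    have "(A *v p)$1 = p'$1 * d / d" "(A *v p)$2 = p'$2 * d / d"
      unfolding mult_vec_2 A_def d_def by (simp_all add: algebra_simps add_divide_distrib diff_divide_distrib)
    then show ?thesis by (simp add: vec_eq_iff forall_2 d0)
  qed
  have r: "A *v r = r'"
  proof -
    have "(A *v r)$1 = r'$1 * d / d" "(A *v r)$2 = r'$2 * d / d"
      unfolding mult_vec_2 A_def d_def by (simp_all add: algebra_simps add_divide_distrib diff_divide_distrib)
    then show ?thesis by (simp add: vec_eq_iff forall_2 d0)
  qed
  have "det A * d = d"
    using det_rows_mult[of A p r] p r assms(1) by (simp add: det_rows_2 d_def)
  then have "det A = 1" using d0 by simp
  with p r show ?thesis by blast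
qed

lemma exists_det_eq:
  fixes p :: "'a::field^2"
  assumes "p \<noteq> 0"
  shows "\<exists>r :: 'a^2. det (vector [p, r] :: 'a^2^2) = d"
proof (cases "p$1 = 0")
  case True
  with assms have "p$2 \<noteq> 0" by (simp add: vec_eq_iff forall_2)
  with True have "det (vector [p, vector [- d / p$2, 0]] :: 'a^2^2) = d" by (simp add: det_rows_2)
  then show ?thesis by blast
next
  case False
  then have "det (vector [p, vector [0, d / p$1]] :: 'a^2^2) = d" by (simp add: det_rows_2)
  then show ?thesis by blast
qed

lemma sl2_transitive:
  fixes p p' :: "'a::field^2"
  assumes "p \<noteq> 0" "p' \<noteq> 0"
  shows "\<exists>A :: 'a^2^2. det A = 1 \<and> A *v p = p'"
proof -
  obtain r r' where "det (vector [p, r] :: 'a^2^2) = 1" "det (vector [p', r'] :: 'a^2^2) = 1"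
    using exists_det_eq[OF assms(1)] exists_det_eq[OF assms(2)] by blast
  then show ?thesis using sl2_transitive_det[of p r p' r'] by auto
qed

lemma sl2_mult_nonzero:
  fixes p :: "'a::field^2"
  assumes "det A = 1" "p \<noteq> 0"
  shows "A *v p \<noteq> 0"
proof
  assume 0: "A *v p = 0"
  obtain r where r: "det (vector [p, r] :: 'a^2^2) = 1" using exists_det_eq[OF assms(2)] by blast
  have "det (vector [A *v p, A *v r] :: 'a^2^2) = 1" using r assms(1) by (simp add: det_rows_mult)
  with 0 show False by (simp add: det_rows_2)
qed

lemma det_zero_collinear:
  fixes p r :: "'a::field^2"
  assumes "p \<noteq> 0" "r \<noteq> 0" "det (vector [p, r] :: 'a^2^2) = 0"
  shows "\<exists>k. k \<noteq> 0 \<and> r = k *s p"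
proof (cases "p$1 = 0")
  case True
  with assms have "p$2 \<noteq> 0" "r$1 = 0" by (auto simp: vec_eq_iff forall_2 det_rows_2)
  with True have "r = (r$2 / p$2) *s p" by (simp add: vec_eq_iff forall_2)
  then show ?thesis using assms(2) by (metis vector_smult_lzero)
next
  case False
  with assms have "r = (r$1 / p$1) *s p"
    by (simp add: vec_eq_iff forall_2 det_rows_2 field_simps)
  then show ?thesis using assms(2) by (metis vector_smult_lzero)
qed

lemma ot_class:
  assumes "mult_subgroup Z" "p \<noteq> 0"
  shows "ot_rel Z `` {p} = (\<lambda>c. c *s p) ` Z"
  using assms by (auto simp: ot_rel_def mult_subgroup_def vec_eq_iff)

lemma ot_points_eq:
  assumes "mult_subgroup Z"
  shows "ot_points Z = {(\<lambda>c. c *s p) ` Z | p. p \<noteq> 0}"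
  unfolding ot_points_def quotient_def using ot_class[OF assms] by (auto; blast)

lemma ot_class_mult:
  fixes A :: "'a::field^2^2"
  shows "(\<lambda>p. A *v p) ` ((\<lambda>c. c *s p) ` Z) = (\<lambda>c. c *s (A *v p)) ` Z"
  by (simp add: image_image vector_scalar_commute)

lemma ot_class_scale:
  assumes Z: "mult_subgroup Z" and z: "z \<in> Z"
  shows "(\<lambda>c. c *s (z *s p)) ` Z = (\<lambda>c. c *s p) ` Z"
proof -
  have "(\<lambda>c. c * z) ` Z = Z"
  proof
    show "(\<lambda>c. c * z) ` Z \<subseteq> Z" using Z z by (auto simp: mult_subgroup_def)
    show "Z \<subseteq> (\<lambda>c. c * z) ` Z"
    proof
      fix x assume "x \<in> Z"
      moreover have "z \<noteq> 0" using Z z by (auto simp: mult_subgroup_def)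
      ultimately have "x * inverse z \<in> Z" "x = (x * inverse z) * z"
        using Z z by (simp_all add: mult_subgroup_def)
      then show "x \<in> (\<lambda>c. c * z) ` Z" by blast
    qed
  qed
  then have "(\<lambda>c. c *s p) ` ((\<lambda>c. c * z) ` Z) = (\<lambda>c. c *s p) ` Z" by simp
  then show ?thesis by (simp add: image_image vector_smult_assoc)
qed

lemma ot_point_rep:
  assumes Z: "mult_subgroup Z" and "P \<in> ot_points Z" "p \<in> P"
  shows "p \<noteq> 0" "P = (\<lambda>c. c *s p) ` Z"
proof -
  obtain s z where s: "s \<noteq> 0" "P = (\<lambda>c. c *s s) ` Z" "z \<in> Z" "p = z *s s"
    using assms ot_points_eq[OF Z] by auto
  show "p \<noteq> 0" using s Z by (auto simp: mult_subgroup_def vec_eq_iff)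
  show "P = (\<lambda>c. c *s p) ` Z" unfolding s(2,4) ot_class_scale[OF Z s(3)] ..
qed

lemma ot_orbit:
  fixes p r :: "'a::field^2"
  assumes "S = (\<lambda>g. (g ((\<lambda>c. c *s p) ` Z), g ((\<lambda>c. c *s r) ` Z))) ` psl2_perms"
  shows "S = {((\<lambda>c. c *s (A *v p)) ` Z, (\<lambda>c. c *s (A *v r)) ` Z) | A :: 'a^2^2. det A = 1}"
  unfolding assms psl2_perms_def by (auto simp: image_image ot_class_mult vector_scalar_commute)

lemma ot_orbit_Delta:
  fixes p r :: "'a::field^2"
  assumes Z: "mult_subgroup Z" and p: "p \<noteq> 0" and r: "r \<noteq> 0"
    and d: "det (vector [p, r] :: 'a^2^2) = d" "d \<noteq> 0"
  shows "(\<lambda>g. (g ((\<lambda>c. c *s p) ` Z), g ((\<lambda>c. c *s r) ` Z))) ` psl2_perms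
           = ot_Delta Z ((\<lambda>z. d * z) ` Z)"
proof (subst ot_orbit[OF refl], intro equalityI subsetI)
  have one: "1 \<in> Z" using Z by (simp add: mult_subgroup_def)
  {
    fix x assume "x \<in> {((\<lambda>c. c *s (A *v p)) ` Z, (\<lambda>c. c *s (A *v r)) ` Z) | A :: 'a^2^2. det A = 1}"
    then obtain A :: "'a^2^2" where A: "det A = 1"
      "x = ((\<lambda>c. c *s (A *v p)) ` Z, (\<lambda>c. c *s (A *v r)) ` Z)" by blast
    have "det (vector [A *v p, A *v r] :: 'a^2^2) \<in> (\<lambda>z. d * z) ` Z"
      using A(1) d one by (auto simp: det_rows_mult intro: image_eqI[of _ _ 1])
    moreover have "A *v p \<in> (\<lambda>c. c *s (A *v p)) ` Z" "A *v r \<in> (\<lambda>c. c *s (A *v r)) ` Z"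
      using one by (auto intro!: image_eqI[of _ _ 1] simp: vec_eq_iff)
    moreover have "A *v p \<noteq> 0" "A *v r \<noteq> 0" using sl2_mult_nonzero A(1) p r by blast+
    ultimately show "x \<in> ot_Delta Z ((\<lambda>z. d * z) ` Z)"
      unfolding A(2) ot_Delta_def ot_points_eq[OF Z] by blast
  next
    fix x assume "x \<in> ot_Delta Z ((\<lambda>z. d * z) ` Z)"
    then obtain P Q p' r' z where x: "x = (P, Q)" "P \<in> ot_points Z" "Q \<in> ot_points Z"
      "p' \<in> P" "r' \<in> Q" "z \<in> Z" "det (vector [p', r'] :: 'a^2^2) = d * z"
      unfolding ot_Delta_def by blast
    have z: "z \<noteq> 0" "inverse z \<in> Z" using Z x(6) by (auto simp: mult_subgroup_def)
    define s where "s = inverse z *s r'"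
    have P: "P = (\<lambda>c. c *s p') ` Z" using ot_point_rep(2)[OF Z x(2,4)] .
    have Q: "Q = (\<lambda>c. c *s s) ` Z"
      unfolding s_def ot_class_scale[OF Z z(2)] using ot_point_rep(2)[OF Z x(3,5)] .
    have "det (vector [p', s] :: 'a^2^2) = inverse z * det (vector [p', r'] :: 'a^2^2)"
      by (simp add: det_rows_2 s_def algebra_simps)
    then have "det (vector [p', s] :: 'a^2^2) = d" using x(7) z(1) by simp
    then obtain A :: "'a^2^2" where "det A = 1" "A *v p = p'" "A *v r = s"
      using sl2_transitive_det[of p r p' s] d by auto
    then show "x \<in> {((\<lambda>c. c *s (A *v p)) ` Z, (\<lambda>c. c *s (A *v r)) ` Z) | A :: 'a^2^2. det A = 1}"
      unfolding x(1) P Q by blast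
  }
qed

lemma ot_orbit_R:
  fixes p :: "'a::field^2"
  assumes Z: "mult_subgroup Z" and p: "p \<noteq> 0" and k: "k \<noteq> 0"
  shows "(\<lambda>g. (g ((\<lambda>c. c *s p) ` Z), g ((\<lambda>c. c *s (k *s p)) ` Z))) ` psl2_perms
           = ot_R Z ((\<lambda>z. k * z) ` Z)"
proof (subst ot_orbit[OF refl], intro equalityI subsetI)
  have one: "1 \<in> Z" using Z by (simp add: mult_subgroup_def)
  {
    fix x assume "x \<in> {((\<lambda>c. c *s (A *v p)) ` Z, (\<lambda>c. c *s (A *v (k *s p))) ` Z) | A :: 'a^2^2. det A = 1}"
    then obtain A :: "'a^2^2" where A: "det A = 1"
      "x = ((\<lambda>c. c *s (A *v p)) ` Z, (\<lambda>c. c *s (k *s (A *v p))) ` Z)"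
      by (auto simp: vector_scalar_commute)
    have "k \<in> (\<lambda>z. k * z) ` Z"
      using one by (auto intro: image_eqI[of _ _ 1])
    moreover have "A *v p \<in> (\<lambda>c. c *s (A *v p)) ` Z" "k *s (A *v p) \<in> (\<lambda>c. c *s (k *s (A *v p))) ` Z"
      using one by (auto intro!: image_eqI[of _ _ 1] simp: vec_eq_iff)
    moreover have n: "A *v p \<noteq> 0" using sl2_mult_nonzero A(1) p by blast
    moreover have "k *s (A *v p) \<noteq> 0" using n k by (auto simp: vec_eq_iff)
    ultimately show "x \<in> ot_R Z ((\<lambda>z. k * z) ` Z)"
      unfolding A(2) ot_R_def ot_points_eq[OF Z] by blast
  next
    fix x assume "x \<in> ot_R Z ((\<lambda>z. k * z) ` Z)"
    then obtain P Q p' r' z where x: "x = (P, Q)" "P \<in> ot_points Z" "Q \<in> ot_points Z"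
      "p' \<in> P" "r' \<in> Q" "z \<in> Z" "r' = (k * z) *s p'"
      unfolding ot_R_def by blast
    have P: "P = (\<lambda>c. c *s p') ` Z" and p': "p' \<noteq> 0" using ot_point_rep[OF Z x(2,4)] by blast+
    have "r' = z *s (k *s p')" using x(7) by (simp add: vector_smult_assoc mult.commute)
    then have Q: "Q = (\<lambda>c. c *s (k *s p')) ` Z"
      using ot_point_rep(2)[OF Z x(3,5)] ot_class_scale[OF Z x(6), of "k *s p'"] by (simp only:)
    obtain A :: "'a^2^2" where "det A = 1" "A *v p = p'" using sl2_transitive[OF p p'] by blast
    then show "x \<in> {((\<lambda>c. c *s (A *v p)) ` Z, (\<lambda>c. c *s (A *v (k *s p))) ` Z) | A :: 'a^2^2. det A = 1}"
      unfolding x(1) P Q by (auto simp: vector_scalar_commute)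
  }
qed

theorem ot_scheme_eq:
  fixes Z :: "'a::field set"
  assumes Z: "mult_subgroup Z"
  shows "ot_scheme Z = ot_R Z ` mult_cosets Z \<union> ot_Delta Z ` mult_cosets Z"
proof (intro equalityI subsetI)
  fix S assume "S \<in> ot_scheme Z"
  then obtain p r where p: "p \<noteq> 0" and r: "r \<noteq> 0" and
    S: "S = (\<lambda>g. (g ((\<lambda>c. c *s p) ` Z), g ((\<lambda>c. c *s r) ` Z))) ` psl2_perms"
    unfolding two_orbits_def ot_points_eq[OF Z] by blast
  show "S \<in> ot_R Z ` mult_cosets Z \<union> ot_Delta Z ` mult_cosets Z"
  proof (cases "det (vector [p, r] :: 'a^2^2) = 0")
    case True
    then obtain k where "k \<noteq> 0" "r = k *s p" using det_zero_collinear p r by blast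
    then have "S = ot_R Z ((\<lambda>z. k * z) ` Z)" using ot_orbit_R[OF Z p] S by simp
    then show ?thesis using \<open>k \<noteq> 0\<close> by (auto simp: mult_cosets_def)
  next
    case False
    then have "S = ot_Delta Z ((\<lambda>z. det (vector [p, r] :: 'a^2^2) * z) ` Z)"
      using ot_orbit_Delta[OF Z p r refl] S by simp
    then show ?thesis using False unfolding mult_cosets_def by blast
  qed
next
  define p :: "'a^2" where "p = vector [1, 0]"
  have p: "p \<noteq> 0" by (simp add: p_def vec_eq_iff forall_2)
  have pt: "(\<lambda>c. c *s q) ` Z \<in> ot_points Z" if "q \<noteq> 0" for q
    using that ot_points_eq[OF Z] by blast
  fix S assume "S \<in> ot_R Z ` mult_cosets Z \<union> ot_Delta Z ` mult_cosets Z"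
  then obtain k where k: "k \<noteq> 0" and
    S: "S = ot_R Z ((\<lambda>z. k * z) ` Z) \<or> S = ot_Delta Z ((\<lambda>z. k * z) ` Z)"
    unfolding mult_cosets_def by blast
  from S show "S \<in> ot_scheme Z"
  proof
    assume S: "S = ot_R Z ((\<lambda>z. k * z) ` Z)"
    have "k *s p \<noteq> 0" using k p by (auto simp: vec_eq_iff)
    then show ?thesis unfolding two_orbits_def S ot_orbit_R[OF Z p k, symmetric]
      using pt p by blast
  next
    assume S: "S = ot_Delta Z ((\<lambda>z. k * z) ` Z)"
    obtain r where r: "det (vector [p, r] :: 'a^2^2) = k" using exists_det_eq[OF p] by blast
    then have "r \<noteq> 0" using k by (auto simp: det_rows_2)
    then show ?thesis unfolding two_orbits_def S ot_orbit_Delta[OF Z p \<open>r \<noteq> 0\<close> r k, symmetric]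
      using pt p by blast
  qed
qed

corollary ot_labellingI:
  assumes "mult_subgroup Z"
    and "bij_betw K {0, 1, 2::nat} (mult_cosets Z)" "K 0 = Z"
    and "bij_betw C {0, 1, 2::nat} (mult_cosets Z)"
  shows "ot_labelling Z (\<lambda>i. ot_R Z (K i)) (\<lambda>i. ot_Delta Z (C i))"
proof -
  have "ot_scheme Z = ot_R Z ` K ` {0, 1, 2} \<union> ot_Delta Z ` C ` {0, 1, 2}"
    using ot_scheme_eq[OF assms(1)] assms(2,4) by (simp add: bij_betw_def)
  then show ?thesis unfolding ot_labelling_def image_image using assms by blast
qed

lemma switching_0_merging:
  assumes "I \<subseteq> \<Omega>" and "R 1 \<union> R 2 \<subseteq> I \<times> I \<union> (\<Omega> - I) \<times> (\<Omega> - I)"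
    and "S \<in> switching_0 \<Omega> R D I"
  shows "\<exists>M \<subseteq> pregraph \<Omega> R D I. S = \<Union>M"
proof -
  have Id: "Id_on \<Omega> = \<Union>{Id_on I, Id_on (\<Omega> - I)}" using assms(1) by auto
  have R12: "R 1 \<union> R 2 = \<Union>{(R 1 \<union> R 2) \<inter> I \<times> I, continent_part \<Omega> I (R 1 \<union> R 2)}"
    using assms(2) unfolding continent_part_def by auto
  consider "S = Id_on \<Omega>" | "S = R 1 \<union> R 2"
    | i j where "i \<in> {0, 1, 2}" "j \<in> {0, 1, 2}"
        "S = continent_part \<Omega> I (D i) \<union> bridge_part \<Omega> I (D j)"
    using assms(3) unfolding switching_0_def by auto
  then show ?thesis
  proof cases
    case 1
    then show ?thesis using Id
      by (intro exI[of _ "{Id_on I, Id_on (\<Omega> - I)}"]) (simp add: pregraph_def)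
  next
    case 2
    show ?thesis unfolding 2
      by (rule exI[of _ "{(R 1 \<union> R 2) \<inter> I \<times> I, continent_part \<Omega> I (R 1 \<union> R 2)}"],
          rule conjI[OF _ R12]) (simp add: pregraph_def)
  next
    case 3
    then show ?thesis
      by (intro exI[of _ "{continent_part \<Omega> I (D i), bridge_part \<Omega> I (D j)}"])
         (auto simp: pregraph_def)
  qed
qed

end

theory Submission
  imports Defs "HOL-Library.Numeral_Type"
begin

text \<open>
  Colour a pair of non-collinear ot-points by the coset of its determinant, and read the labels
  of the three cosets as residues modulo 3. Multiplication by a field element outside \<open>Z\<close>
  permutes the cosets without a fixed point, so that it shifts the labels by a constant
  (\<open>label_mult\<close>). Hence moving a point within its fiber adds a constant to all its colours, and
  a fiber carries each colour exactly once towards a point outside it. Determinants against two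
  independent vectors are coordinates of the plane (\<open>card_pdet\<close>), which gives the number of
  paths \<open>P, X, Q\<close> with colours \<open>h, k\<close>: it is \<open>l\<close> for all \<open>h\<close> and \<open>k\<close> if \<open>P\<close> and
  \<open>Q\<close> are not collinear.

  The switching \<open>Sw\<^sub>0\<close> exchanges the colours 1 and 2 on the bridges, which is negation modulo 3.
  Both colours of a path change sign or neither does, except if exactly one end of the path is on
  the island; the count is then \<open>l\<close> before and after the switching, for all colours. Otherwise
  the affected paths between given ends have a constant difference \<open>h - k\<close> of their colours,
  since the middle points of these paths form a single fiber or the ends are in a common fiber.
  Negation turns this difference into \<open>k - h\<close>. So switching merely exchanges the roles of the
  two colours for the affected paths, and the numbers of paths with colours \<open>h, k\<close> and with
  colours \<open>k, h\<close> keep their sum (\<open>path_count_not_E\<close>, \<open>path_count_fiber\<close>). These sums are,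
  up to the factor 2, the entries of Jordan products, and they show that the switched relations
  span a Jordan algebra (\<open>jordan_prod_switched_rel\<close>).

  The individual counts do change, which makes the scheme proper. Suppose that it is the
  symmetrization of an association scheme. The adjacency matrices of the switched relations lie
  in the span of that scheme, and so does the ordinary product of those with colours 0 and 1. This
  product is constant on a relation \<open>S\<close> for which \<open>S \<union> S\<inverse>\<close> is the relation of distinct
  collinear points. But \<open>S\<close> meets the island, where the entries are 0 and \<open>q\<close>, and also the
  continent, where they are 1 and \<open>q - 1\<close> (\<open>proper_switched_relations\<close>).
\<close>


section \<open>Arithmetic modulo 3\<close>

lemma z3_cases: "x = 0 \<or> x = 1 \<or> x = 2" for x :: 3
  using exhaust_3[of x] by auto

lemma of_nat_z3_inj: "i \<in> {0, 1, 2} \<Longrightarrow> j \<in> {0, 1, 2} \<Longrightarrow> (of_nat i :: 3) = of_nat j \<Longrightarrow> i = j"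
  by (elim insertE emptyE) simp_all

lemma z3_double_eq_0_iff: "t + t = 0 \<longleftrightarrow> t = 0" for t :: 3
  using z3_cases[of t] by auto

text \<open>A permutation of three elements without a fixed point is a 3-cycle, and both 3-cycles are
  translations.\<close>

lemma z3_fixpoint_free_shift:
  fixes f :: "3 \<Rightarrow> 3"
  assumes "inj f" "\<And>x. f x \<noteq> x"
  shows "f x = x + f 0"
proof -
  have "f 0 \<noteq> f 1" "f 0 \<noteq> f 2" "f 1 \<noteq> f 2" using assms(1) by (simp_all add: inj_eq)
  then show ?thesis
    using z3_cases[of x] z3_cases[of "f 0"] z3_cases[of "f 1"] z3_cases[of "f 2"]
      assms(2)[of 0] assms(2)[of 1] assms(2)[of 2] by auto
qed

text \<open>As \<open>1\<close> and \<open>-1\<close> are the only nonzero residues, distinct residues differ by \<open>t\<close> or by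
  \<open>-t\<close>, and not by both, whenever \<open>t\<close> is nonzero.\<close>

lemma z3_shift_cases:
  fixes h k t :: 3
  assumes "h \<noteq> k"
  shows "(of_bool (k = h + t) + of_bool (k = h - t) :: nat) = of_bool (t \<noteq> 0)"
proof -
  define d where "d = k - h"
  have "k = h + t \<longleftrightarrow> d = t" "k = h - t \<longleftrightarrow> d = - t" and "d \<noteq> 0"
    using assms by (auto simp: d_def algebra_simps)
  then show ?thesis using z3_cases[of d] z3_cases[of t] by auto
qed


section \<open>Spans of adjacency matrices\<close>

lemma adj_mat_nth [simp]: "adj_mat S $ x $ y = of_bool ((x, y) \<in> S)"
  by (simp add: adj_mat_def)

lemma adj_mat_mult_nth:
  "(adj_mat S ** adj_mat T) $ x $ y = real (card {z. (x, z) \<in> S \<and> (z, y) \<in> T})"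
  by (simp add: matrix_matrix_mult_def Collect_conj_eq)

lemma adj_mat_Un: "S \<inter> T = {} \<Longrightarrow> adj_mat (S \<union> T) = adj_mat S + adj_mat T"
  by (auto simp: vec_eq_iff)

lemma adj_mat_Diff: "T \<subseteq> S \<Longrightarrow> adj_mat (S - T) = adj_mat S - adj_mat T"
  by (auto simp: vec_eq_iff)

text \<open>Distinct relations of a partition are disjoint, so each generator of the span is constant on
  each relation.\<close>

lemma span_adj_mat_const:
  assumes P: "partition_on \<Omega> \<S>" and S: "S \<in> \<S>" and M: "M \<in> span (adj_mat ` \<S>)"
    and "(x, y) \<in> S" "(x', y') \<in> S"
  shows "M $ x $ y = M $ x' $ y'"
  using M
proof (induction rule: span_induct_alt)
  case base
  show ?case by simp
next
  case (step c A N)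
  then obtain T where T: "T \<in> \<S>" "A = adj_mat T" by blast
  have "(x, y) \<in> T \<longleftrightarrow> (x', y') \<in> T"
  proof (cases "T = S")
    case True
    then show ?thesis using assms(4,5) by simp
  next
    case False
    then have "T \<inter> S = {}" using P T(1) S by (auto simp: partition_on_def disjoint_def)
    then show ?thesis using assms(4,5) by auto
  qed
  with step T show ?case by simp
qed

text \<open>The relations of a scheme split those of its symmetrization into at most two transposed
  parts, so that the span of a scheme contains the span of its symmetrization.\<close>

lemma adj_mat_symmetrization_in_span:
  assumes A: "association_scheme \<Omega> \<A>" and T: "T \<in> symmetrization \<A>"
  shows "adj_mat T \<in> span (adj_mat ` \<A>)"
proof -
  obtain S where S: "S \<in> \<A>" "T = S \<union> S\<inverse>" using T by (auto simp: symmetrization_def)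
  have S': "S\<inverse> \<in> \<A>" using A S(1) by (auto simp: association_scheme_def)
  show ?thesis
  proof (cases "S = S\<inverse>")
    case True
    then show ?thesis using S by (auto intro: span_base)
  next
    case False
    then have "S \<inter> S\<inverse> = {}"
      using A S(1) S' by (auto simp: association_scheme_def partition_on_def disjoint_def)
    then show ?thesis using S S' by (auto simp: adj_mat_Un intro: span_add span_base)
  qed
qed

lemma jordan_prod_commute: "jordan_prod A B = jordan_prod B A"
  by (simp add: jordan_prod_def add.commute)

lemma linear_jordan_prod:
  fixes A :: "real^'b::finite^'b"
  shows "linear (jordan_prod A)"
proof (rule linearI)
  have "(B + C) ** D = B ** D + C ** D" for B C D :: "real^'b^'b"
    by (simp add: matrix_matrix_mult_def vec_eq_iff sum.distrib distrib_right)
  then show "jordan_prod A (x + y) = jordan_prod A x + jordan_prod A y" for x y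
    by (simp add: jordan_prod_def matrix_add_ldistrib scaleR_add_right)
  show "jordan_prod A (c *\<^sub>R x) = c *\<^sub>R jordan_prod A x" for c x
    by (simp add: jordan_prod_def matrix_scalar_ac scalar_matrix_assoc[symmetric] scaleR_add_right)
qed

text \<open>The Jordan product is linear in its second argument and commutative, which reduces closure
  of a span to its generators.\<close>

lemma jordan_prod_span_closed:
  assumes gen: "\<And>A B. A \<in> G \<Longrightarrow> B \<in> G \<Longrightarrow> jordan_prod A B \<in> span G"
    and A: "A \<in> span G" and B: "B \<in> span G"
  shows "jordan_prod A B \<in> span G"
proof -
  have closed: "jordan_prod A B \<in> span G"
    if "\<And>C. C \<in> G \<Longrightarrow> jordan_prod A C \<in> span G" and B: "B \<in> span G" for A B
  proof -
    have "jordan_prod A B \<in> jordan_prod A ` span G" using B by simp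
    also have "\<dots> = span (jordan_prod A ` G)"
      by (rule linear_span_image[symmetric, OF linear_jordan_prod])
    also have "\<dots> \<subseteq> span G"
      using that(1) by (intro span_minimal) auto
    finally show ?thesis .
  qed
  show ?thesis
    using closed[of A B] closed[of _ A] gen A B jordan_prod_commute by metis
qed


section \<open>Threefold covers of complete graphs with a switched fiber\<close>

text \<open>
  What the proof uses of the ot-points: \<open>E\<close> is collinearity, \<open>col\<close> the colour of a pair of
  non-collinear points, and \<open>\<delta> P Q\<close> the amount by which colours change on passing from \<open>P\<close>
  to the collinear point \<open>Q\<close>. The fibers are thus torsors under the integers modulo 3, as in a
  cyclic threefold cover of a complete graph.
\<close>

locale ternary_cover =
  fixes \<Omega> :: "'b::finite set" and E :: "('b \<times> 'b) set"
    and col \<delta> :: "'b \<Rightarrow> 'b \<Rightarrow> 3" and l q :: nat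
  assumes equiv_E: "equiv \<Omega> E"
    and nonempty: "\<Omega> \<noteq> {}"
    and q_ge_2: "2 \<le> q"
    and col_sym: "P \<in> \<Omega> \<Longrightarrow> Q \<in> \<Omega> \<Longrightarrow> (P, Q) \<notin> E \<Longrightarrow> col P Q = col Q P"
    and col_shift: "(P, Q) \<in> E \<Longrightarrow> X \<in> \<Omega> \<Longrightarrow> (P, X) \<notin> E \<Longrightarrow> col Q X = col P X + \<delta> P Q"
    and shift_bij: "P \<in> \<Omega> \<Longrightarrow> bij_betw (\<delta> P) (E `` {P}) UNIV"
    and valency: "P \<in> \<Omega> \<Longrightarrow> card {X \<in> \<Omega>. (P, X) \<notin> E \<and> col P X = h} = q"
    and paths: "P \<in> \<Omega> \<Longrightarrow> Q \<in> \<Omega> \<Longrightarrow> (P, Q) \<notin> E \<Longrightarrow>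
      card {X \<in> \<Omega>. (P, X) \<notin> E \<and> (X, Q) \<notin> E \<and> col P X = h \<and> col X Q = k} = l"
begin

lemma E_refl: "P \<in> \<Omega> \<Longrightarrow> (P, P) \<in> E"
  using equiv_E by (meson equivE refl_onD)

lemma E_sym: "(P, Q) \<in> E \<Longrightarrow> (Q, P) \<in> E"
  using equiv_E by (meson equivE symD)

lemma E_trans: "(P, Q) \<in> E \<Longrightarrow> (Q, X) \<in> E \<Longrightarrow> (P, X) \<in> E"
  using equiv_E by (meson equivE transD)

lemma E_field: "(P, Q) \<in> E \<Longrightarrow> P \<in> \<Omega>" "(P, Q) \<in> E \<Longrightarrow> Q \<in> \<Omega>"
  using equiv_type[OF equiv_E] by auto

lemma ex_not_E:
  assumes "P \<in> \<Omega>"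
  obtains X where "X \<in> \<Omega>" "(P, X) \<notin> E" "col P X = h"
proof -
  have "{X \<in> \<Omega>. (P, X) \<notin> E \<and> col P X = h} \<noteq> {}"
    using valency[OF assms, of h] q_ge_2 by (metis card.empty not_numeral_le_zero)
  then show ?thesis using that by blast
qed

lemma delta_eq_0_iff:
  assumes "(P, Q) \<in> E"
  shows "\<delta> P Q = 0 \<longleftrightarrow> P = Q"
proof -
  have P: "P \<in> \<Omega>" using assms E_field by blast
  obtain X where "X \<in> \<Omega>" "(P, X) \<notin> E" using ex_not_E[OF P] by blast
  then have "\<delta> P P = 0" using col_shift[of P P X] E_refl[OF P] by simp
  moreover have "inj_on (\<delta> P) (E `` {P})" using shift_bij[OF P] by (simp add: bij_betw_def)
  ultimately show ?thesis using assms E_refl[OF P] by (metis Image_singleton_iff inj_onD)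
qed

lemma card_fiber_shift:
  assumes "X \<in> \<Omega>"
  shows "card {Y \<in> E `` {X}. \<phi> (\<delta> X Y)} = card {d. \<phi> d}"
proof (rule bij_betw_same_card[of "\<delta> X"])
  show "bij_betw (\<delta> X) {Y \<in> E `` {X}. \<phi> (\<delta> X Y)} {d. \<phi> d}"
    using shift_bij[OF assms] unfolding bij_betw_def inj_on_def by force
qed

lemma col_fiber:
  assumes "P \<in> \<Omega>" "(P, X) \<notin> E" "(X, Y) \<in> E"
  shows "col Y P = col X P + \<delta> X Y" "col P Y = col P X + \<delta> X Y" "(P, Y) \<notin> E" "(Y, P) \<notin> E"
proof -
  show n: "(P, Y) \<notin> E" "(Y, P) \<notin> E" using assms E_sym E_trans by blast+
  show "col Y P = col X P + \<delta> X Y" using col_shift assms E_sym by blast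
  then show "col P Y = col P X + \<delta> X Y"
    using n col_sym assms E_field E_sym by metis
qed

lemma card_fiber_col:
  assumes "P \<in> \<Omega>" "X \<in> \<Omega>" "(P, X) \<notin> E"
  shows "card {Y \<in> E `` {X}. col P Y = h} = 1"
proof -
  have "{Y \<in> E `` {X}. col P Y = h} = {Y \<in> E `` {X}. \<delta> X Y = h - col P X}"
    using col_fiber(2)[OF assms(1,3)] by (auto simp: algebra_simps)
  then show ?thesis using card_fiber_shift[OF assms(2), of "\<lambda>d. d = h - col P X"] by simp
qed

lemma card_fiber_paths:
  assumes "P \<in> \<Omega>" "Q \<in> \<Omega>" "X \<in> \<Omega>" "(P, X) \<notin> E" "(X, Q) \<notin> E"
  shows "card {Y \<in> E `` {X}. col P Y = h \<and> col Y Q = k} = of_bool (h - col P X = k - col X Q)"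
proof -
  have "{Y \<in> E `` {X}. col P Y = h \<and> col Y Q = k}
      = {Y \<in> E `` {X}. \<delta> X Y = h - col P X \<and> \<delta> X Y = k - col X Q}"
  proof (intro Collect_cong conj_cong refl)
    fix Y assume "Y \<in> E `` {X}"
    then have "col P Y = col P X + \<delta> X Y" "col Y Q = col X Q + \<delta> X Y"
      using col_fiber(2)[OF assms(1,4)] col_fiber(1)[OF assms(2)] assms(5) E_sym by blast+
    then show "col P Y = h \<longleftrightarrow> \<delta> X Y = h - col P X" "col Y Q = k \<longleftrightarrow> \<delta> X Y = k - col X Q"
      by (simp_all add: eq_diff_eq add.commute)
  qed
  moreover have "card {d. d = h - col P X \<and> d = k - col X Q} = of_bool (h - col P X = k - col X Q)"
  proof (cases "h - col P X = k - col X Q")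
    case True
    then have "{d. d = h - col P X \<and> d = k - col X Q} = {h - col P X}" by auto
    then show ?thesis using True by simp
  next
    case False
    then have "{d. d = h - col P X \<and> d = k - col X Q} = {}" by auto
    then show ?thesis using False by (simp only: card.empty of_bool_eq)
  qed
  ultimately show ?thesis
    using card_fiber_shift[OF assms(3), of "\<lambda>d. d = h - col P X \<and> d = k - col X Q"] by simp
qed

end

locale switched_cover = ternary_cover +
  fixes I :: "'b::finite set"
  assumes island: "I \<in> \<Omega> // E"
begin

text \<open>The colours 1 and 2 are negatives of each other modulo 3, so that negation on the bridges is
  the switching that fixes the colour 0.\<close>

definition switched_col :: "'b \<Rightarrow> 'b \<Rightarrow> 3" where
  "switched_col P Q = (if P \<in> I \<longleftrightarrow> Q \<in> I then col P Q else - col P Q)"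

definition switched_rel :: "3 \<Rightarrow> ('b \<times> 'b) set" where
  "switched_rel h = {(P, Q). P \<in> \<Omega> \<and> Q \<in> \<Omega> \<and> (P, Q) \<notin> E \<and> switched_col P Q = h}"

definition path_count :: "3 \<Rightarrow> 3 \<Rightarrow> 'b \<Rightarrow> 'b \<Rightarrow> nat" where
  "path_count h k P Q = card {X. (P, X) \<in> switched_rel h \<and> (X, Q) \<in> switched_rel k}"

lemma island_subset: "P \<in> I \<Longrightarrow> P \<in> \<Omega>"
  using island in_quotient_imp_subset[OF equiv_E] by blast

lemma island_closed: "(P, Q) \<in> E \<Longrightarrow> P \<in> I \<longleftrightarrow> Q \<in> I"
  using island in_quotient_imp_closed[OF equiv_E] E_sym by metis

lemma island_eq: "P \<in> I \<Longrightarrow> I = E `` {P}"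
  using island island_closed in_quotient_imp_in_rel[OF equiv_E] by blast

lemma switched_col_sym: "P \<in> \<Omega> \<Longrightarrow> Q \<in> \<Omega> \<Longrightarrow> (P, Q) \<notin> E \<Longrightarrow> switched_col P Q = switched_col Q P"
  using col_sym by (auto simp: switched_col_def)

lemma switched_rel_sym: "(P, Q) \<in> switched_rel h \<Longrightarrow> (Q, P) \<in> switched_rel h"
  using switched_col_sym E_sym by (auto simp: switched_rel_def)

lemma path_count_swap: "path_count h k P Q = path_count k h Q P"
proof -
  have "{X. (P, X) \<in> switched_rel h \<and> (X, Q) \<in> switched_rel k} = {X. (Q, X) \<in> switched_rel k \<and> (X, P) \<in> switched_rel h}"
    using switched_rel_sym by blast
  then show ?thesis by (simp add: path_count_def)
qed

lemma obtain_island: obtains P where "P \<in> I"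
  using island in_quotient_imp_non_empty[OF equiv_E] by blast

text \<open>A path of length two that joins the island to the continent meets neither end fiber in
  between; hence it uses one bridge, and switching only permutes the colours of that step.\<close>

lemma path_count_bridge:
  assumes "P \<in> I" "Q \<in> \<Omega>" "(P, Q) \<notin> E"
  shows "path_count h k P Q = l"
proof -
  have P: "P \<in> \<Omega>" using assms(1) island_subset by blast
  have "(P, X) \<in> switched_rel h \<and> (X, Q) \<in> switched_rel k \<longleftrightarrow>
      X \<in> \<Omega> \<and> (P, X) \<notin> E \<and> (X, Q) \<notin> E \<and> col P X = - h \<and> col X Q = k" for X
  proof (cases "X \<in> \<Omega> \<and> (P, X) \<notin> E")
    case True
    then have "X \<notin> I" using island_eq[OF assms(1)] by simp
    moreover have "Q \<notin> I" using island_eq[OF assms(1)] assms(3) by simp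
    ultimately show ?thesis
      using True assms P by (simp add: switched_rel_def switched_col_def neg_eq_iff_add_eq_0 eq_neg_iff_add_eq_0 add.commute conj_ac)
  qed (auto simp: switched_rel_def)
  then have "{X. (P, X) \<in> switched_rel h \<and> (X, Q) \<in> switched_rel k} =
      {X \<in> \<Omega>. (P, X) \<notin> E \<and> (X, Q) \<notin> E \<and> col P X = - h \<and> col X Q = k}" by auto
  then show ?thesis using paths[OF P assms(2,3)] by (simp add: path_count_def)
qed

text \<open>Between two points of the continent, switching negates both colours of a path through the
  island. Such a path exists for the colours \<open>(h, k)\<close> iff the differences of these colours to
  those of a fixed path agree, and negating both colours has the same effect as exchanging them.
  So switching replaces the contribution of the island to the count for \<open>(h, k)\<close> by the one to
  the count for \<open>(k, h)\<close>, which does not affect the sum of the two counts.\<close>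

lemma path_count_continent:
  assumes "P \<in> \<Omega>" "P \<notin> I" "Q \<in> \<Omega>" "Q \<notin> I" "(P, Q) \<notin> E"
  shows "path_count h k P Q + path_count k h P Q = 2 * l"
proof -
  obtain X where X: "X \<in> I" by (rule obtain_island)
  have X\<Omega>: "X \<in> \<Omega>" "(P, X) \<notin> E" "(X, Q) \<notin> E"
    using X assms island_subset island_closed by blast+
  \<comment> \<open>The middle points on the continent and on the island, with respect to the colours
    before the switching.\<close>
  define C where "C h k = {Y \<in> \<Omega> - I. (P, Y) \<notin> E \<and> (Y, Q) \<notin> E \<and> col P Y = h \<and> col Y Q = k}" for h k
  define J where "J h k = {Y \<in> I. col P Y = h \<and> col Y Q = k}" for h k
  have fin: "finite (C h k)" "finite (J h k)" "C h k \<inter> J h' k' = {}" for h k h' k'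
    by (auto simp: C_def J_def)
  have J: "card (J h k) = of_bool (h - col P X = k - col X Q)" for h k
    unfolding J_def using card_fiber_paths[OF assms(1,3) X\<Omega>] island_eq[OF X] by simp
  have J_neg: "card (J (- h) (- k)) = card (J k h)" for h k
  proof -
    have "- h - a = - k - b \<longleftrightarrow> k - a = h - b" for a b
      unfolding eq_iff_diff_eq_0[of "- h - a"] eq_iff_diff_eq_0[of "k - a"]
      by (simp add: algebra_simps)
    then show ?thesis unfolding J by simp
  qed
  have notE: "(P, Y) \<notin> E" "(Y, Q) \<notin> E" "Y \<in> \<Omega>" if "Y \<in> I" for Y
    using that assms island_closed island_subset by blast+
  have sum: "card (C h k) + card (J h k) = l" for h k
  proof -
    have "{Y \<in> \<Omega>. (P, Y) \<notin> E \<and> (Y, Q) \<notin> E \<and> col P Y = h \<and> col Y Q = k} = C h k \<union> J h k"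
      using notE by (auto simp: C_def J_def)
    then show ?thesis
      using paths[OF assms(1,3,5), of h k] card_Un_disjoint[OF fin, of h k h k] by simp
  qed
  have N: "path_count h k P Q = card (C h k) + card (J k h)" for h k
  proof -
    have "{Y. (P, Y) \<in> switched_rel h \<and> (Y, Q) \<in> switched_rel k} = C h k \<union> J (- h) (- k)"
      using notE assms by (auto simp: C_def J_def switched_rel_def switched_col_def)
    then show ?thesis
      using card_Un_disjoint[OF fin, of h k "- h" "- k"] J_neg by (simp add: path_count_def)
  qed
  show ?thesis using sum[of h k] sum[of k h] unfolding N by simp
qed

lemma path_count_not_E:
  assumes "P \<in> \<Omega>" "Q \<in> \<Omega>" "(P, Q) \<notin> E"
  shows "path_count h k P Q + path_count k h P Q = 2 * l"
proof -
  consider "P \<in> I" | "Q \<in> I" | "P \<notin> I" "Q \<notin> I" by blast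
  then show ?thesis
  proof cases
    case 1
    then show ?thesis using path_count_bridge assms by simp
  next
    case 2
    then have "path_count h k Q P = l" for h k using path_count_bridge assms E_sym by blast
    then show ?thesis using path_count_swap[of _ _ P Q] by simp
  next
    case 3
    then show ?thesis using path_count_continent assms by blast
  qed
qed

text \<open>The colours of the two steps of a path between \<open>P\<close> and \<open>Q\<close> in one fiber differ by
  \<open>\<delta> P Q\<close>, or by its negative if both steps are bridges. All paths that start on the island
  consist of bridges; of the \<open>q\<close> paths that start on the continent with a given colour, exactly
  one does. This is where the island and the continent can be told apart.\<close>

lemma path_count_fiber_island:
  assumes "(P, Q) \<in> E" "P \<in> I"
  shows "path_count h k P Q = q * of_bool (k = h - \<delta> P Q)"
proof -
  have P: "P \<in> \<Omega>" "Q \<in> \<Omega>" "Q \<in> I" using assms E_field island_closed by blast+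
  have "(P, X) \<in> switched_rel h \<and> (X, Q) \<in> switched_rel k \<longleftrightarrow>
      X \<in> \<Omega> \<and> (P, X) \<notin> E \<and> col P X = - h \<and> k = h - \<delta> P Q" for X
  proof (cases "X \<in> \<Omega> \<and> (P, X) \<notin> E")
    case True
    then have "(X, Q) \<notin> E" "X \<notin> I" using assms E_sym E_trans island_eq[OF assms(2)] by blast+
    moreover have "col X Q = col P X + \<delta> P Q"
      using col_fiber(2)[of X P Q] col_sym[OF P(1), of X] True assms(1) E_sym by auto
    ultimately show ?thesis using True P assms by (auto simp: switched_rel_def switched_col_def)
  qed (auto simp: switched_rel_def)
  then have "{X. (P, X) \<in> switched_rel h \<and> (X, Q) \<in> switched_rel k} =
      (if k = h - \<delta> P Q then {X \<in> \<Omega>. (P, X) \<notin> E \<and> col P X = - h} else {})" by auto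
  then show ?thesis using valency[OF P(1), of "- h"] by (simp add: path_count_def)
qed

lemma path_count_fiber_continent:
  assumes "(P, Q) \<in> E" "P \<notin> I"
  shows "path_count h k P Q = (q - 1) * of_bool (k = h + \<delta> P Q) + of_bool (k = h - \<delta> P Q)"
proof -
  have P: "P \<in> \<Omega>" "Q \<in> \<Omega>" "Q \<notin> I" using assms E_field island_closed by blast+
  obtain X0 where X0: "X0 \<in> I" by (rule obtain_island)
  have X0\<Omega>: "X0 \<in> \<Omega>" "(P, X0) \<notin> E" using X0 assms island_subset island_closed by blast+
  have notE: "(P, Y) \<notin> E" "(Y, Q) \<notin> E" "Y \<in> \<Omega>" if "Y \<in> I" for Y
    using that assms P island_closed island_subset by blast+
  have col: "col X Q = col P X + \<delta> P Q" if "X \<in> \<Omega>" "(P, X) \<notin> E" for X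
    using col_fiber(2)[of X P Q] col_sym[OF P(1), of X] that assms(1) E_sym by auto
  define C where "C h = {X \<in> \<Omega> - I. (P, X) \<notin> E \<and> col P X = h}" for h
  define J where "J h = {X \<in> I. col P X = h}" for h
  have fin: "finite (C h)" "finite (J h)" "C h \<inter> J h' = {}" for h h'
    by (auto simp: C_def J_def)
  have J: "card (J h) = 1" for h
    unfolding J_def using card_fiber_col[OF P(1) X0\<Omega>] island_eq[OF X0] by simp
  have "{X \<in> \<Omega>. (P, X) \<notin> E \<and> col P X = h} = C h \<union> J h" for h
    using notE by (auto simp: C_def J_def)
  then have C: "card (C h) = q - 1" for h
    using valency[OF P(1), of h] card_Un_disjoint[OF fin, of h h] J[of h] by simp
  have "(P, X) \<in> switched_rel h \<and> (X, Q) \<in> switched_rel k \<longleftrightarrow>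
      X \<in> C h \<and> k = h + \<delta> P Q \<or> X \<in> J (- h) \<and> k = h - \<delta> P Q" for X
  proof (cases "X \<in> \<Omega> \<and> (P, X) \<notin> E")
    case True
    then have "(X, Q) \<notin> E" using assms E_sym E_trans by blast
    then show ?thesis using True P assms col[of X] by (auto simp: switched_rel_def switched_col_def C_def J_def)
  next
    case False
    then show ?thesis using notE(1,3) by (auto simp: switched_rel_def C_def J_def)
  qed
  then have "{X. (P, X) \<in> switched_rel h \<and> (X, Q) \<in> switched_rel k} =
      (if k = h + \<delta> P Q then C h else {}) \<union> (if k = h - \<delta> P Q then J (- h) else {})" by auto
  then show ?thesis
    using card_Un_disjoint[of "if k = h + \<delta> P Q then C h else {}" "if k = h - \<delta> P Q then J (- h) else {}"]
      fin C J by (auto simp: path_count_def)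
qed

lemma path_count_fiber:
  assumes "(P, Q) \<in> E"
  shows "path_count h k P Q + path_count k h P Q = q * (of_bool (k = h + \<delta> P Q) + of_bool (k = h - \<delta> P Q))"
proof -
  have *: "h = k - \<delta> P Q \<longleftrightarrow> k = h + \<delta> P Q" "h = k + \<delta> P Q \<longleftrightarrow> k = h - \<delta> P Q"
    by (auto simp: algebra_simps)
  show ?thesis
  proof (cases "P \<in> I")
    case True
    show ?thesis unfolding path_count_fiber_island[OF assms True] * by (simp add: algebra_simps)
  next
    case False
    have "q = Suc (q - 1)" using q_ge_2 by simp
    then show ?thesis unfolding path_count_fiber_continent[OF assms False] *
      by (smt (verit) add.assoc add.commute add_mult_distrib2 mult.commute mult_Suc_right)
  qed
qed

lemma not_E_Un_switched_rel: "\<Omega> \<times> \<Omega> - E = switched_rel 0 \<union> switched_rel 1 \<union> switched_rel 2"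
  using z3_cases by (auto simp: switched_rel_def)

lemma switched_rel_disjoint: "h \<noteq> k \<Longrightarrow> switched_rel h \<inter> switched_rel k = {}"
  by (auto simp: switched_rel_def)

text \<open>The sums of path counts see only whether the ends are equal or collinear. For a fiber and
  \<open>h \<noteq> k\<close> this is because \<open>k - h\<close> is one of \<open>\<delta> P Q\<close> and \<open>- \<delta> P Q\<close> as soon as \<open>P\<close> and
  \<open>Q\<close> are distinct.\<close>

lemma jordan_prod_switched_rel:
  "jordan_prod (adj_mat (switched_rel h)) (adj_mat (switched_rel k)) =
     real l *\<^sub>R adj_mat (\<Omega> \<times> \<Omega> - E) +
     (if h = k then real q *\<^sub>R adj_mat (Id_on \<Omega>) else (real q / 2) *\<^sub>R adj_mat (E - Id_on \<Omega>))"
    (is "?L = ?R")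
proof -
  have "?L $ P $ Q = ?R $ P $ Q" for P Q
  proof -
    have L: "?L $ P $ Q = real (path_count h k P Q + path_count k h P Q) / 2"
      by (simp add: jordan_prod_def adj_mat_mult_nth path_count_def)
    consider "P \<notin> \<Omega> \<or> Q \<notin> \<Omega>" | "P \<in> \<Omega>" "Q \<in> \<Omega>" "(P, Q) \<notin> E" | "(P, Q) \<in> E" by blast
    then show ?thesis
    proof cases
      case 1
      then have "path_count h k P Q = 0" for h k by (auto simp: path_count_def switched_rel_def)
      then show ?thesis using 1 E_field unfolding L by auto
    next
      case 2
      then show ?thesis unfolding L path_count_not_E[OF 2] using E_refl by auto
    next
      case 3
      note P = E_field[OF 3]
      show ?thesis
      proof (cases "h = k")
        case True
        then show ?thesis unfolding L path_count_fiber[OF 3] using 3 P delta_eq_0_iff[OF 3] by auto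
      next
        case False
        then show ?thesis unfolding L path_count_fiber[OF 3] z3_shift_cases[OF False]
          using 3 P delta_eq_0_iff[OF 3] by auto
      qed
    qed
  qed
  then show ?thesis by (simp add: vec_eq_iff)
qed

text \<open>The points of a fiber are on the same side of the island's boundary, and negation permutes
  the colours. So a fiber still carries each colour once towards a point outside it.\<close>

lemma card_fiber_switched_col:
  assumes "(P, Q) \<notin> E" "P \<in> \<Omega>" "Q \<in> \<Omega>"
  shows "card {X. (P, X) \<in> E \<and> (X, Q) \<in> switched_rel h} = 1"
proof -
  define h' where "h' = (if P \<in> I \<longleftrightarrow> Q \<in> I then h else - h)"
  have "(Q, P) \<notin> E" using assms(1) E_sym by blast
  have "(P, X) \<in> E \<and> (X, Q) \<in> switched_rel h \<longleftrightarrow> X \<in> E `` {P} \<and> col Q X = h'" for X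
  proof (cases "(P, X) \<in> E")
    case True
    then have "(X, Q) \<notin> E" "X \<in> \<Omega>" "P \<in> I \<longleftrightarrow> X \<in> I"
      using assms(1) E_trans E_field island_closed by blast+
    moreover have "col Q X = col X Q" using calculation assms(3) col_sym by simp
    ultimately show ?thesis
      using True assms(3) by (auto simp: switched_rel_def switched_col_def h'_def)
  qed simp
  then have "{X. (P, X) \<in> E \<and> (X, Q) \<in> switched_rel h} = {X \<in> E `` {P}. col Q X = h'}" by blast
  then show ?thesis using card_fiber_col[OF assms(3,2) \<open>(Q, P) \<notin> E\<close>] by simp
qed

lemma card_fiber: "P \<in> \<Omega> \<Longrightarrow> card (E `` {P}) = 3"
  using bij_betw_same_card[OF shift_bij] by simp

lemma E_mult_switched_rel: "adj_mat E ** adj_mat (switched_rel h) = adj_mat (\<Omega> \<times> \<Omega> - E)"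
proof -
  have "card {X. (P, X) \<in> E \<and> (X, Q) \<in> switched_rel h} = of_bool ((P, Q) \<in> \<Omega> \<times> \<Omega> - E)" for P Q
  proof (cases "(P, Q) \<in> \<Omega> \<times> \<Omega> - E")
    case True
    then show ?thesis using card_fiber_switched_col by simp
  next
    case False
    have "(P, Q) \<in> \<Omega> \<times> \<Omega> - E" if "(P, X) \<in> E" "(X, Q) \<in> switched_rel h" for X
    proof -
      have "Q \<in> \<Omega>" "(X, Q) \<notin> E" using that(2) by (auto simp: switched_rel_def)
      then show ?thesis using that(1) E_field E_sym E_trans by blast
    qed
    then have "{X. (P, X) \<in> E \<and> (X, Q) \<in> switched_rel h} = {}" using False by blast
    then show ?thesis using False by (simp only: card.empty of_bool_eq)
  qed
  then show ?thesis by (simp add: vec_eq_iff adj_mat_mult_nth)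
qed

lemma switched_rel_mult_E: "adj_mat (switched_rel h) ** adj_mat E = adj_mat (\<Omega> \<times> \<Omega> - E)"
proof -
  have tr: "transpose (adj_mat S) = adj_mat S" if "sym S" for S :: "('b \<times> 'b) set"
    using that by (auto simp: vec_eq_iff transpose_def dest: symD)
  have "sym E" "sym (switched_rel h)" "sym (\<Omega> \<times> \<Omega> - E)"
    using E_sym switched_rel_sym unfolding sym_def by blast+
  then have "transpose (adj_mat E) = adj_mat E" "transpose (adj_mat (switched_rel h)) = adj_mat (switched_rel h)"
    "transpose (adj_mat (\<Omega> \<times> \<Omega> - E)) = adj_mat (\<Omega> \<times> \<Omega> - E)"
    using tr by blast+
  then show ?thesis using E_mult_switched_rel[of h] by (metis matrix_transpose_mul)
qed

lemma E_mult_E: "adj_mat E ** adj_mat E = 3 *\<^sub>R adj_mat E"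
proof -
  have "card {X. (P, X) \<in> E \<and> (X, Q) \<in> E} = 3 * of_bool ((P, Q) \<in> E)" for P Q
  proof (cases "(P, Q) \<in> E")
    case True
    then have "{X. (P, X) \<in> E \<and> (X, Q) \<in> E} = E `` {P}" using E_sym E_trans by blast
    then show ?thesis using True card_fiber E_field by simp
  next
    case False
    then have "{X. (P, X) \<in> E \<and> (X, Q) \<in> E} = {}" using E_trans by blast
    then show ?thesis using False by (simp only: card.empty of_bool_eq)
  qed
  then show ?thesis by (simp add: vec_eq_iff adj_mat_mult_nth)
qed

definition switched_relations :: "('b \<times> 'b) set set" where
  "switched_relations = {Id_on \<Omega>, E - Id_on \<Omega>, switched_rel 0, switched_rel 1, switched_rel 2}"

lemma switched_rel_in_switched_relations: "switched_rel h \<in> switched_relations"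
  using z3_cases[of h] by (auto simp: switched_relations_def)

lemma partition_on_switched_relations: "partition_on (\<Omega> \<times> \<Omega>) switched_relations"
proof (rule partition_onI)
  obtain P where P: "P \<in> \<Omega>" using nonempty by blast
  have "\<exists>X. (P, X) \<in> switched_rel h" for h
  proof -
    obtain X where "X \<in> \<Omega>" "(P, X) \<notin> E" using ex_not_E[OF P] by blast
    then have "card {Y. (X, Y) \<in> E \<and> (Y, P) \<in> switched_rel h} = 1"
      using card_fiber_switched_col P E_sym by blast
    then have "{Y. (X, Y) \<in> E \<and> (Y, P) \<in> switched_rel h} \<noteq> {}" by (metis card.empty zero_neq_one)
    then show ?thesis using switched_rel_sym by blast
  qed
  then have "switched_rel h \<noteq> {}" for h by blast
  moreover have "Id_on \<Omega> \<noteq> {}" using P by blast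
  moreover have "E - Id_on \<Omega> \<noteq> {}"
  proof
    assume "E - Id_on \<Omega> = {}"
    then have "E `` {P} \<subseteq> {P}" by blast
    then have "card (E `` {P}) \<le> 1" using card_mono[of "{P}" "E `` {P}"] by simp
    then show False using card_fiber[OF P] by simp
  qed
  ultimately show "{} \<notin> switched_relations"
    unfolding switched_relations_def by (metis empty_iff insert_iff)
  have "switched_rel h \<inter> E = {}" "Id_on \<Omega> \<subseteq> E" for h using E_refl by (auto simp: switched_rel_def)
  then have "disjnt (switched_rel h) (E - Id_on \<Omega>)" "disjnt (switched_rel h) (Id_on \<Omega>)"
     "disjnt (E - Id_on \<Omega>) (switched_rel h)" "disjnt (Id_on \<Omega>) (switched_rel h)"
     "disjnt (E - Id_on \<Omega>) (Id_on \<Omega>)" "disjnt (Id_on \<Omega>) (E - Id_on \<Omega>)" for h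
    by (auto simp: disjnt_def)
  moreover have "disjnt (switched_rel h) (switched_rel k)" if "switched_rel h \<noteq> switched_rel k" for h k
    using that switched_rel_disjoint by (metis disjnt_def)
  ultimately show "disjnt p p'" if "p \<in> switched_relations" "p' \<in> switched_relations" "p \<noteq> p'" for p p'
    using that unfolding switched_relations_def by blast
  have "\<Omega> \<times> \<Omega> = E \<union> (\<Omega> \<times> \<Omega> - E)" "E = Id_on \<Omega> \<union> (E - Id_on \<Omega>)"
    using E_field E_refl by auto
  then show "\<Union>switched_relations = \<Omega> \<times> \<Omega>"
    using not_E_Un_switched_rel unfolding switched_relations_def by auto
qed

text \<open>The products are simpler for \<open>E\<close> than for \<open>E - Id\<close>. As the identity is among the
  generators, replacing one by the other does not change the span.\<close>

theorem jordan_scheme_switched_relations: "jordan_scheme \<Omega> switched_relations"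
proof -
  let ?G = "{adj_mat (Id_on \<Omega>), adj_mat E} \<union> range (\<lambda>h. adj_mat (switched_rel h))"
  have adj_E: "adj_mat (E - Id_on \<Omega>) = adj_mat E - adj_mat (Id_on \<Omega>)"
    using E_refl by (intro adj_mat_Diff) auto
  have Id: "adj_mat (Id_on \<Omega>) \<in> span ?G" and E: "adj_mat E \<in> span ?G"
    and B: "adj_mat (switched_rel h) \<in> span ?G" for h
    by (auto intro: span_base)
  have EId: "adj_mat (E - Id_on \<Omega>) \<in> span ?G"
    unfolding adj_E by (rule span_diff[OF E Id])
  have span_G: "span (adj_mat ` switched_relations) = span ?G"
  proof -
    have "adj_mat ` switched_relations \<subseteq> span ?G"
      unfolding switched_relations_def using Id EId B by blast
    moreover have "?G \<subseteq> span (adj_mat ` switched_relations)"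
    proof -
      have "adj_mat (Id_on \<Omega>) \<in> span (adj_mat ` switched_relations)"
        "adj_mat (E - Id_on \<Omega>) \<in> span (adj_mat ` switched_relations)"
        "adj_mat (switched_rel h) \<in> span (adj_mat ` switched_relations)" for h
        using switched_rel_in_switched_relations
        by (blast intro: span_base imageI switched_relations_def[THEN equalityD2, THEN subsetD])+
      moreover from span_add[OF this(2,1)] have "adj_mat E \<in> span (adj_mat ` switched_relations)"
        by (simp add: adj_E)
      ultimately show ?thesis by blast
    qed
    ultimately show ?thesis by (simp only: span_eq)
  qed
  have "adj_mat (\<Omega> \<times> \<Omega> - E) = adj_mat (switched_rel 0) + adj_mat (switched_rel 1) + adj_mat (switched_rel 2)"
  proof -
    have "(switched_rel 0 \<union> switched_rel 1) \<inter> switched_rel 2 = {}" "switched_rel 0 \<inter> switched_rel 1 = {}" by (auto simp: switched_rel_def)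
    then show ?thesis by (simp only: not_E_Un_switched_rel adj_mat_Un)
  qed
  then have U: "adj_mat (\<Omega> \<times> \<Omega> - E) \<in> span ?G"
    using B by (auto intro!: span_add)
  have jId: "jordan_prod (adj_mat (Id_on \<Omega>)) (adj_mat S) = adj_mat S" if "S \<subseteq> \<Omega> \<times> \<Omega>" for S
  proof -
    have "{z. (x, z) \<in> Id_on \<Omega> \<and> (z, y) \<in> S} = (if (x, y) \<in> S then {x} else {})"
      "{z. (x, z) \<in> S \<and> (z, y) \<in> Id_on \<Omega>} = (if (x, y) \<in> S then {y} else {})" for x y
      using that by auto
    then show ?thesis by (simp add: jordan_prod_def vec_eq_iff adj_mat_mult_nth)
  qed
  have jEE: "jordan_prod (adj_mat E) (adj_mat E) = 3 *\<^sub>R adj_mat E"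
    by (simp add: jordan_prod_def E_mult_E flip: scaleR_2)
  have jEB: "jordan_prod (adj_mat E) (adj_mat (switched_rel h)) = adj_mat (\<Omega> \<times> \<Omega> - E)" for h
    by (simp add: jordan_prod_def E_mult_switched_rel switched_rel_mult_E flip: scaleR_2)
  have jBB: "jordan_prod (adj_mat (switched_rel h)) (adj_mat (switched_rel k)) \<in> span ?G" for h k
    unfolding jordan_prod_switched_rel using U Id EId by (simp add: span_add span_scale)
  have sub: "Id_on \<Omega> \<subseteq> \<Omega> \<times> \<Omega>" "E \<subseteq> \<Omega> \<times> \<Omega>" "switched_rel h \<subseteq> \<Omega> \<times> \<Omega>" for h
    using E_field by (auto simp: switched_rel_def)
  have gen: "jordan_prod A M \<in> span ?G" if "A \<in> ?G" "M \<in> ?G" for A M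
  proof -
    have Id_gen: "jordan_prod (adj_mat (Id_on \<Omega>)) C \<in> span ?G" if "C \<in> ?G" for C
      using that jId sub by (auto intro: span_base)
    consider "A = adj_mat (Id_on \<Omega>) \<or> M = adj_mat (Id_on \<Omega>)"
      | "A = adj_mat E" "M = adj_mat E"
      | h where "A = adj_mat E" "M = adj_mat (switched_rel h)"
      | h where "A = adj_mat (switched_rel h)" "M = adj_mat E"
      | h k where "A = adj_mat (switched_rel h)" "M = adj_mat (switched_rel k)"
      using \<open>A \<in> ?G\<close> \<open>M \<in> ?G\<close> by blast
    then show ?thesis
    proof cases
      case 1
      then show ?thesis using Id_gen \<open>A \<in> ?G\<close> \<open>M \<in> ?G\<close> jordan_prod_commute by metis
    next
      case 2
      then show ?thesis using E by (simp only: jEE span_scale)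
    next
      case 3
      then show ?thesis using U by (simp only: jEB)
    next
      case 4
      then show ?thesis using U by (simp only: jEB jordan_prod_commute[of _ "adj_mat E"])
    next
      case 5
      then show ?thesis using jBB by blast
    qed
  qed
  have "\<forall>A \<in> span ?G. \<forall>M \<in> span ?G. jordan_prod A M \<in> span ?G"
    using jordan_prod_span_closed[of ?G] gen by blast
  moreover have "sym S" if "S \<in> switched_relations" for S
    using that E_sym switched_rel_sym unfolding switched_relations_def sym_def by blast
  moreover have "Id_on \<Omega> \<in> switched_relations" by (simp add: switched_relations_def)
  ultimately show ?thesis
    using partition_on_switched_relations unfolding jordan_scheme_def span_G by blast
qed

text \<open>By \<open>path_count_fiber_island\<close> and \<open>path_count_fiber_continent\<close>, the product of the
  switched relations of colours 0 and 1 distinguishes the pairs of distinct points in the fiber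
  \<open>I\<close> from those in other fibers. In an association scheme with the given symmetrization some
  relation would contain pairs of both kinds.\<close>

theorem proper_switched_relations: "proper_jordan_scheme \<Omega> switched_relations"
proof -
  have False if A: "association_scheme \<Omega> \<A>" and eq: "switched_relations = symmetrization \<A>" for \<A>
  proof -
    have B: "adj_mat (switched_rel h) \<in> span (adj_mat ` \<A>)" for h
      using adj_mat_symmetrization_in_span[OF A] switched_rel_in_switched_relations eq by blast
    define M where "M = adj_mat (switched_rel 0) ** adj_mat (switched_rel 1)"
    have M: "M \<in> span (adj_mat ` \<A>)"
      unfolding M_def using A B by (auto simp: association_scheme_def)
    have M_nth: "M $ P $ Q = real (path_count 0 1 P Q)" for P Q
      by (simp add: M_def adj_mat_mult_nth path_count_def)
    have "E - Id_on \<Omega> \<in> symmetrization \<A>" using eq by (auto simp: switched_relations_def)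
    then obtain S where S: "S \<in> \<A>" "E - Id_on \<Omega> = S \<union> S\<inverse>" by (auto simp: symmetrization_def)
    have part: "partition_on (\<Omega> \<times> \<Omega>) \<A>" using A by (simp add: association_scheme_def)
    \<comment> \<open>If \<open>S\<close> does not contain a pair of distinct points of a fiber, it contains the reversed pair.\<close>
    have pair: "\<exists>P' Q'. (P', Q') \<in> S \<and> (P', Q') \<in> E \<and> P' \<noteq> Q' \<and> (P' \<in> I \<longleftrightarrow> P \<in> I)"
      if P: "P \<in> \<Omega>" for P
    proof -
      have "\<not> E `` {P} \<subseteq> {P}"
        using card_fiber[OF P] card_mono[of "{P}" "E `` {P}"] by auto
      then obtain Q where Q: "(P, Q) \<in> E" "P \<noteq> Q" by blast
      then have "(P, Q) \<in> S \<union> S\<inverse>" using S(2) by blast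
      then show ?thesis using Q E_sym island_closed by blast
    qed
    obtain P0 where P0: "P0 \<in> I" by (rule obtain_island)
    then obtain X where "X \<in> \<Omega>" "(P0, X) \<notin> E" using ex_not_E island_subset by blast
    then have "X \<in> \<Omega>" "X \<notin> I" using island_eq[OF P0] by auto
    then obtain P Q where PQ: "(P, Q) \<in> S" "(P, Q) \<in> E" "P \<noteq> Q" "P \<notin> I" using pair by blast
    obtain P' Q' where PQ': "(P', Q') \<in> S" "(P', Q') \<in> E" "P' \<in> I"
      using pair P0 island_subset by blast
    have "path_count 0 1 P Q = path_count 0 1 P' Q'"
      using span_adj_mat_const[OF part S(1) M PQ(1) PQ'(1)] by (simp add: M_nth)
    moreover have "path_count 0 1 P' Q' \<in> {0, q}" using path_count_fiber_island[OF PQ'(2,3)] by simp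
    moreover have "path_count 0 1 P Q \<in> {1, q - 1}"
    proof -
      have "\<delta> P Q \<noteq> 0" using delta_eq_0_iff[OF PQ(2)] PQ(3) by simp
      then have "(of_bool (1 = 0 + \<delta> P Q) + of_bool (1 = 0 - \<delta> P Q) :: nat) = 1"
        using z3_shift_cases[of 0 1 "\<delta> P Q"] by simp
      then show ?thesis unfolding path_count_fiber_continent[OF PQ(2,4)]
        by (cases "1 = 0 + \<delta> P Q"; cases "1 = 0 - \<delta> P Q") simp_all
    qed
    ultimately show False using q_ge_2 by auto
  qed
  then show ?thesis
    using jordan_scheme_switched_relations by (auto simp: proper_jordan_scheme_def)
qed

end


section \<open>Coordinates in the plane\<close>

definition rep :: "('a::field^2) set \<Rightarrow> 'a^2" where
  "rep P = (SOME p. p \<in> P)"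

definition pdet :: "'a::field^2 \<Rightarrow> 'a^2 \<Rightarrow> 'a" where
  "pdet p r = det (vector [p, r] :: 'a^2^2)"

definition rdet :: "('a::field^2) set \<Rightarrow> ('a^2) set \<Rightarrow> 'a" where
  "rdet P Q = pdet (rep P) (rep Q)"

lemma pdet_scale: "pdet (c *s p) r = c * pdet p r" "pdet p (c *s r) = c * pdet p r"
  by (simp_all add: pdet_def det_rows_2 algebra_simps)

lemma pdet_swap: "pdet r p = - pdet p r"
  by (simp add: pdet_def det_rows_2)

lemma smult_cancel: "p \<noteq> 0 \<Longrightarrow> c *s p = d *s p \<longleftrightarrow> c = d" for p :: "'a::field^2"
  by (auto simp: vec_eq_iff)

lemma smult_eq_0_iff: "c *s p = 0 \<longleftrightarrow> c = 0 \<or> p = 0" for p :: "'a::field^2"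
  by (auto simp: vec_eq_iff)

lemma pdet_0: "pdet p 0 = 0" "pdet 0 p = 0"
  by (simp_all add: pdet_def det_rows_2)

text \<open>For independent \<open>p\<close> and \<open>r\<close>, the determinants against \<open>p\<close> and \<open>r\<close> are coordinates of
  the plane, by Cramer's rule.\<close>

lemma card_pdet:
  fixes p r :: "'a::{field,finite}^2"
  assumes "pdet p r \<noteq> 0"
  shows "card {x. pdet p x \<in> A \<and> pdet x r \<in> B} = card A * card B"
proof -
  define f where "f x = (pdet p x, pdet x r)" for x
  define g where "g ab = (fst ab / pdet p r) *s r + (snd ab / pdet p r) *s p" for ab
  have fg: "f (g ab) = ab" for ab
  proof -
    have add: "pdet p (x + y) = pdet p x + pdet p y" "pdet (x + y) r = pdet x r + pdet y r"
      "pdet p p = 0" "pdet r r = 0" for x y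
      by (simp_all add: pdet_def det_rows_2 algebra_simps)
    show ?thesis using assms by (simp add: f_def g_def add pdet_scale prod_eq_iff)
  qed
  then have "surj f" by (metis surjI)
  moreover have "inj f"
  proof (rule injI)
    fix x y assume eq: "f x = f y"
    have "g (f x) = x" for x
    proof -
      have "pdet p x * r $ i + pdet x r * p $ i = pdet p r * x $ i" for i
        using exhaust_2[of i] by (auto simp: pdet_def det_rows_2 algebra_simps)
      then show ?thesis
        using assms by (simp add: vec_eq_iff g_def f_def flip: add_divide_distrib)
    qed
    then show "x = y" using eq by metis
  qed
  moreover have "f -` (A \<times> B) = {x. pdet p x \<in> A \<and> pdet x r \<in> B}" by (auto simp: f_def)
  ultimately show ?thesis using card_vimage_inj[of f "A \<times> B"] by (simp add: card_cartesian_product)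
qed

section \<open>Cosets of a subgroup of index three\<close>

lemma mult_coset_eq:
  assumes Z: "mult_subgroup Z" and c: "c \<in> mult_cosets Z" and x: "x \<in> c"
  shows "x \<noteq> 0" "c = {y. y \<noteq> 0 \<and> y / x \<in> Z}"
proof -
  obtain a z where a: "a \<noteq> 0" "c = (\<lambda>z. a * z) ` Z" "z \<in> Z" "x = a * z"
    using c x by (auto simp: mult_cosets_def)
  have z: "z \<noteq> 0" using a Z by (auto simp: mult_subgroup_def)
  then show "x \<noteq> 0" using a by simp
  show "c = {y. y \<noteq> 0 \<and> y / x \<in> Z}"
  proof (intro equalityI subsetI CollectI)
    fix y assume "y \<in> c"
    then obtain w where w: "w \<in> Z" "y = a * w" using a by blast
    have "y / x = w * inverse z" using w a z by (simp add: field_simps)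
    then show "y \<noteq> 0 \<and> y / x \<in> Z" using w a(1,3) Z by (auto simp: mult_subgroup_def)
  next
    fix y assume "y \<in> {y. y \<noteq> 0 \<and> y / x \<in> Z}"
    then have "y / x * z \<in> Z" using a(3) Z by (auto simp: mult_subgroup_def)
    moreover have "y = a * (y / x * z)" using a(1,4) z by (simp add: field_simps)
    ultimately show "y \<in> c" using a(2) by blast
  qed
qed

lemma ex_mult_coset:
  assumes "mult_subgroup Z" "x \<noteq> 0"
  shows "\<exists>c \<in> mult_cosets Z. x \<in> c"
proof -
  have "x \<in> (\<lambda>z. x * z) ` Z" using assms(1) by (auto simp: mult_subgroup_def intro: image_eqI[of _ _ 1])
  then show ?thesis by (rule bexI) (use assms(2) in \<open>auto simp: mult_cosets_def\<close>)
qed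

lemma mult_cosets_nonempty: "mult_subgroup Z \<Longrightarrow> c \<in> mult_cosets Z \<Longrightarrow> c \<noteq> {}"
  by (auto simp: mult_cosets_def mult_subgroup_def)

locale labelled_cosets =
  fixes Z :: "'a::{field,finite} set" and C :: "nat \<Rightarrow> 'a set"
  assumes Z: "mult_subgroup Z" and C: "bij_betw C {0, 1, 2} (mult_cosets Z)"
begin

lemma Z_facts: "0 \<notin> Z" "1 \<in> Z" "x \<in> Z \<Longrightarrow> y \<in> Z \<Longrightarrow> x * y \<in> Z" "x \<in> Z \<Longrightarrow> inverse x \<in> Z"
  using Z by (auto simp: mult_subgroup_def)

definition label :: "'a \<Rightarrow> 3" where
  "label x = (if x \<in> C 0 then 0 else if x \<in> C 1 then 1 else 2)"

lemma C_cosets: "i \<in> {0, 1, 2} \<Longrightarrow> C i \<in> mult_cosets Z"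
  using C by (auto simp: bij_betw_def)

lemma C_disjoint:
  assumes "x \<in> C i" "x \<in> C j" "i \<in> {0, 1, 2}" "j \<in> {0, 1, 2}"
  shows "i = j"
proof -
  have "C i = C j" using assms mult_coset_eq(2)[OF Z C_cosets] by blast
  then show ?thesis using C assms(3,4) by (auto simp: bij_betw_def dest: inj_onD)
qed

lemma ex_C:
  assumes "x \<noteq> 0"
  obtains i where "i \<in> {0, 1, 2}" "x \<in> C i"
  using ex_mult_coset[OF Z assms] C unfolding bij_betw_def by (metis imageE)

lemma label_C:
  assumes "i \<in> {0, 1, 2}" "x \<in> C i"
  shows "label x = of_nat i"
  using assms C_disjoint[OF assms(2) _ assms(1), of 0] C_disjoint[OF assms(2) _ assms(1), of 1]
  by (auto simp: label_def)

lemma mem_C_iff: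
  assumes "x \<noteq> 0" "i \<in> {0, 1, 2}"
  shows "x \<in> C i \<longleftrightarrow> label x = of_nat i"
proof -
  obtain j where j: "j \<in> {0, 1, 2}" "x \<in> C j" using ex_C[OF assms(1)] .
  then have "label x = of_nat j" by (rule label_C)
  then show ?thesis using j assms(2) C_disjoint of_nat_z3_inj by metis
qed

lemma label_eq_iff:
  assumes "x \<noteq> 0" "y \<noteq> 0"
  shows "label x = label y \<longleftrightarrow> y / x \<in> Z"
proof -
  obtain i where i: "i \<in> {0, 1, 2}" "x \<in> C i" using ex_C[OF assms(1)] .
  have "label x = label y \<longleftrightarrow> y \<in> C i"
    using mem_C_iff[OF assms(2) i(1)] label_C[OF i] by metis
  then show ?thesis using mult_coset_eq(2)[OF Z C_cosets[OF i(1)] i(2)] assms(2) by simp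
qed

lemma label_surj: obtains x where "x \<noteq> 0" "label x = s"
proof -
  obtain i :: nat where i: "i \<in> {0, 1, 2}" "s = of_nat i"
    using z3_cases[of s] by (metis insertI1 insertI2 of_nat_0 of_nat_1 of_nat_numeral)
  obtain x where "x \<in> C i" using mult_cosets_nonempty[OF Z C_cosets[OF i(1)]] by blast
  then show ?thesis
    using that label_C[OF i(1)] i(2) mult_coset_eq(1)[OF Z C_cosets[OF i(1)]] by blast
qed

text \<open>The label of 1 is subtracted because any of the cosets may carry the label 0.\<close>

definition shift :: "'a \<Rightarrow> 3" where
  "shift t = label t - label 1"

lemma shift_eq_0_iff: "t \<noteq> 0 \<Longrightarrow> shift t = 0 \<longleftrightarrow> t \<in> Z"
  using label_eq_iff[of 1 t] by (auto simp: shift_def)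

text \<open>Multiplication by an element outside \<open>Z\<close> permutes the three cosets without a fixed point,
  and the only such permutations of three labels are the two nontrivial shifts. This holds for
  every labelling of the cosets.\<close>

lemma label_mult:
  assumes "t \<noteq> 0" "x \<noteq> 0"
  shows "label (t * x) = label x + shift t"
proof (cases "t \<in> Z")
  case True
  then have "label x = label (t * x)" using label_eq_iff[of x "t * x"] assms by simp
  then show ?thesis using shift_eq_0_iff assms True by simp
next
  case False
  define g where "g s = (SOME x. x \<noteq> 0 \<and> label x = s)" for s
  have "g s \<noteq> 0 \<and> label (g s) = s" for s
    unfolding g_def by (rule someI_ex) (metis label_surj)
  then have g: "g s \<noteq> 0" "label (g s) = s" for s by blast+
  \<comment> \<open>The permutation of the labels that multiplication by \<open>t\<close> induces.\<close>
  define f where "f s = label (t * g s)" for s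
  have mult_iff: "label (t * x) = label (t * y) \<longleftrightarrow> label x = label y" if "x \<noteq> 0" "y \<noteq> 0" for x y
    using that assms(1) label_eq_iff[of "t * x" "t * y"] label_eq_iff[of x y] by simp
  have f: "f (label y) = label (t * y)" if "y \<noteq> 0" for y
    unfolding f_def using mult_iff[of "g (label y)" y] g that by blast
  have "inj f"
    by (rule injI) (use mult_iff g in \<open>metis f_def\<close>)
  moreover have "f s \<noteq> s" for s
  proof
    assume "f s = s"
    then have "label (g s) = label (t * g s)" using g by (simp add: f_def)
    then show False using label_eq_iff[of "g s" "t * g s"] g assms(1) False by simp
  qed
  ultimately have shift: "f s = s + f 0" for s by (rule z3_fixpoint_free_shift)
  have "label t = label 1 + f 0" using shift[of "label 1"] f[of 1] by simp
  then show ?thesis using shift[of "label x"] f[OF assms(2)] by (simp add: shift_def)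
qed

text \<open>Since \<open>(-1)\<^sup>2 = 1\<close>, the shift of \<open>-1\<close> has order at most 2 modulo 3 and so vanishes. This makes
  the colour of a pair of points symmetric.\<close>

lemma label_minus: "label (- x) = label x"
proof (cases "x = 0")
  case False
  have "label (- x) = label x + shift (- 1)" "label x = label (- x) + shift (- 1)"
    using label_mult[of "- 1" x] label_mult[of "- 1" "- x"] False by simp_all
  then have "shift (- 1) + shift (- 1) = 0" by (metis add.assoc add_cancel_left_right)
  then show ?thesis using \<open>label (- x) = label x + shift (- 1)\<close> z3_double_eq_0_iff by simp
qed simp

lemma card_label: "card {x. x \<noteq> 0 \<and> label x = s} = card Z"
proof -
  obtain x where x: "x \<noteq> 0" "label x = s" by (rule label_surj)
  have "{y. y \<noteq> 0 \<and> label y = s} = (\<lambda>z. x * z) ` Z"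
  proof (intro equalityI subsetI)
    fix y assume "y \<in> {y. y \<noteq> 0 \<and> label y = s}"
    then have "y / x \<in> Z" "y = x * (y / x)" using x label_eq_iff[of x y] by auto
    then show "y \<in> (\<lambda>z. x * z) ` Z" by blast
  next
    fix y assume "y \<in> (\<lambda>z. x * z) ` Z"
    then obtain z where "z \<in> Z" "y = x * z" by blast
    moreover have "z \<noteq> 0" using \<open>z \<in> Z\<close> Z_facts by blast
    ultimately show "y \<in> {y. y \<noteq> 0 \<and> label y = s}" using x label_eq_iff[of x y] by auto
  qed
  then show ?thesis using x(1) by (simp add: card_image inj_on_def)
qed

end


section \<open>The ot-points form a threefold cover\<close>

context labelled_cosets
begin

definition collinear :: "(('a^2) set \<times> ('a^2) set) set" where
  "collinear = {(P, Q). P \<in> ot_points Z \<and> Q \<in> ot_points Z \<and> rdet P Q = 0}"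

lemma ot_point_of: "p \<noteq> 0 \<Longrightarrow> (\<lambda>c. c *s p) ` Z \<in> ot_points Z"
  unfolding ot_points_eq[OF Z] by (intro CollectI exI[of _ p]) simp

lemma rep_in:
  assumes "P \<in> ot_points Z"
  shows "rep P \<in> P"
proof -
  have "P \<noteq> {}" using assms Z_facts(2) unfolding ot_points_eq[OF Z] by blast
  then show ?thesis by (simp add: rep_def some_in_eq)
qed

lemma rep_nonzero: "P \<in> ot_points Z \<Longrightarrow> rep P \<noteq> 0"
  using ot_point_rep(1)[OF Z _ rep_in] .

lemma ot_point_eq_orbit: "P \<in> ot_points Z \<Longrightarrow> P = (\<lambda>c. c *s rep P) ` Z"
  using ot_point_rep(2)[OF Z _ rep_in] .

text \<open>Representatives of the same ot-point differ by a factor in \<open>Z\<close>, so a single choice of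
  representatives decides both kinds of 2-orbits.\<close>

lemma ot_Delta_iff:
  assumes P: "P \<in> ot_points Z" and Q: "Q \<in> ot_points Z" and c: "c \<in> mult_cosets Z"
  shows "(P, Q) \<in> ot_Delta Z c \<longleftrightarrow> rdet P Q \<in> c"
proof
  assume "rdet P Q \<in> c"
  then show "(P, Q) \<in> ot_Delta Z c"
    using P Q rep_in unfolding ot_Delta_def rdet_def pdet_def by blast
next
  assume "(P, Q) \<in> ot_Delta Z c"
  then obtain p r where pr: "p \<in> P" "r \<in> Q" "pdet p r \<in> c"
    unfolding ot_Delta_def pdet_def by blast
  obtain y where y: "y \<in> Z" "p = y *s rep P" using ot_point_eq_orbit[OF P] pr(1) by blast
  obtain z where z: "z \<in> Z" "r = z *s rep Q" using ot_point_eq_orbit[OF Q] pr(2) by blast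
  have 1: "pdet p r = y * z * rdet P Q" by (simp add: y z pdet_scale rdet_def mult.commute)
  have nz: "y \<noteq> 0" "z \<noteq> 0" "rdet P Q \<noteq> 0"
    using y(1) z(1) Z_facts(1) mult_coset_eq(1)[OF Z c pr(3)] 1 by auto
  have "rdet P Q / pdet p r = inverse y * inverse z" unfolding 1 using nz by (simp add: field_simps)
  then have "rdet P Q / pdet p r \<in> Z" using y z Z_facts by simp
  then show "rdet P Q \<in> c" using nz(3) mult_coset_eq(2)[OF Z c pr(3)] by simp
qed

lemma ot_R_iff:
  assumes P: "P \<in> ot_points Z" and Q: "Q \<in> ot_points Z" and c: "c \<in> mult_cosets Z"
  shows "(P, Q) \<in> ot_R Z c \<longleftrightarrow> (\<exists>k\<in>c. rep Q = k *s rep P)"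
proof
  assume "\<exists>k\<in>c. rep Q = k *s rep P"
  then show "(P, Q) \<in> ot_R Z c"
    using P Q rep_in unfolding ot_R_def by blast
next
  assume "(P, Q) \<in> ot_R Z c"
  then obtain p r k where pr: "p \<in> P" "r \<in> Q" "k \<in> c" "r = k *s p"
    unfolding ot_R_def by blast
  obtain y where y: "y \<in> Z" "p = y *s rep P" using ot_point_eq_orbit[OF P] pr(1) by blast
  obtain z where z: "z \<in> Z" "r = z *s rep Q" using ot_point_eq_orbit[OF Q] pr(2) by blast
  have nz: "y \<noteq> 0" "z \<noteq> 0" "k \<noteq> 0"
    using y(1) z(1) Z_facts(1) mult_coset_eq(1)[OF Z c pr(3)] by auto
  have "rep Q = inverse z *s r" using nz by (simp add: z vector_smult_assoc)
  then have 1: "rep Q = (inverse z * k * y) *s rep P" by (simp add: pr(4) y(2) vector_smult_assoc mult.assoc)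
  have "inverse z * k * y / k = inverse z * y" using nz by simp
  then have "inverse z * k * y \<in> c"
    using mult_coset_eq(2)[OF Z c pr(3)] nz y(1) z(1) Z_facts(3,4) by simp
  then show "\<exists>k\<in>c. rep Q = k *s rep P" using 1 by blast
qed

lemma collinear_iff:
  "(P, Q) \<in> collinear \<longleftrightarrow>
     P \<in> ot_points Z \<and> Q \<in> ot_points Z \<and> (\<exists>k. k \<noteq> 0 \<and> rep Q = k *s rep P)"
proof -
  have "pdet p (k *s p) = 0" for k p by (simp add: pdet_def det_rows_2)
  then show ?thesis
    using det_zero_collinear[OF rep_nonzero rep_nonzero]
    unfolding collinear_def rdet_def by (auto simp: pdet_def)
qed

lemma equiv_collinear: "equiv (ot_points Z) collinear"
proof (rule equivI)
  show "collinear \<subseteq> ot_points Z \<times> ot_points Z" by (auto simp: collinear_def)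
  show "refl_on (ot_points Z) collinear"
    by (rule refl_onI) (auto simp: collinear_iff intro!: exI[of _ 1])
  show "sym collinear"
  proof (rule symI)
    fix P Q assume "(P, Q) \<in> collinear"
    then show "(Q, P) \<in> collinear" using pdet_swap[of "rep Q" "rep P"] by (auto simp: collinear_def rdet_def)
  qed
  show "trans collinear"
  proof (rule transI)
    fix P Q X assume "(P, Q) \<in> collinear" "(Q, X) \<in> collinear"
    then obtain k m where "k \<noteq> 0" "rep Q = k *s rep P" "m \<noteq> 0" "rep X = m *s rep Q"
      and PX: "P \<in> ot_points Z" "X \<in> ot_points Z"
      unfolding collinear_iff by blast
    then have "m * k \<noteq> 0" "rep X = (m * k) *s rep P" by (simp_all add: vector_smult_assoc)
    then show "(P, X) \<in> collinear" unfolding collinear_iff using PX by blast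
  qed
qed

definition offset :: "('a^2) set \<Rightarrow> ('a^2) set \<Rightarrow> 3" where
  "offset P Q = shift (SOME k. rep Q = k *s rep P)"

lemma offset_eq:
  assumes "P \<in> ot_points Z" "rep Q = k *s rep P"
  shows "offset P Q = shift k"
proof -
  have "(SOME k. rep Q = k *s rep P) = k"
    using assms smult_cancel[OF rep_nonzero] by (intro some_equality) auto
  then show ?thesis by (simp add: offset_def)
qed

lemma ot_point_eqI:
  assumes "P \<in> ot_points Z" "Q \<in> ot_points Z" "p \<in> P" "p \<in> Q"
  shows "P = Q"
  using ot_point_rep(2)[OF Z assms(1,3)] ot_point_rep(2)[OF Z assms(2,4)] by simp

text \<open>A point collinear with \<open>P\<close> is given by a scalar factor up to \<open>Z\<close>, that is, by a coset,
  and hence by the shift of this factor.\<close>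

lemma offset_bij:
  assumes P: "P \<in> ot_points Z"
  shows "bij_betw (offset P) (collinear `` {P}) UNIV"
proof (rule bij_betw_imageI)
  show "inj_on (offset P) (collinear `` {P})"
  proof (rule inj_onI)
    fix Q X assume "Q \<in> collinear `` {P}" "X \<in> collinear `` {P}" and eq: "offset P Q = offset P X"
    then obtain k m where k: "k \<noteq> 0" "rep Q = k *s rep P" "m \<noteq> 0" "rep X = m *s rep P"
      and QX: "Q \<in> ot_points Z" "X \<in> ot_points Z"
      by (auto simp: collinear_iff)
    then have "label k = label m"
      using eq offset_eq[OF P k(2)] offset_eq[OF P k(4)] by (simp add: shift_def)
    then have "m / k \<in> Z" using label_eq_iff k by simp
    moreover have "rep X = (m / k) *s rep Q" using k by (simp add: vector_smult_assoc)
    ultimately have "rep X \<in> Q" using ot_point_eq_orbit[OF QX(1)] by blast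
    then show "Q = X" using ot_point_eqI QX rep_in by blast
  qed
  show "offset P ` (collinear `` {P}) = UNIV"
  proof (intro equalityI subsetI UNIV_I)
    fix s :: 3
    obtain k where k: "k \<noteq> 0" "label k = s + label 1" by (rule label_surj)
    let ?Q = "(\<lambda>c. c *s (k *s rep P)) ` Z"
    have Q: "?Q \<in> ot_points Z"
      by (rule ot_point_of) (use k(1) rep_nonzero[OF P] in \<open>simp add: smult_eq_0_iff\<close>)
    then obtain z where z: "z \<in> Z" "rep ?Q = (z * k) *s rep P"
      using rep_in[OF Q] by (auto simp: vector_smult_assoc)
    have z0: "z \<noteq> 0" using z Z_facts by blast
    then have "shift (z * k) = s"
      using k label_mult[of z k] z shift_eq_0_iff[of z] by (simp add: shift_def)
    then have "offset P ?Q = s" using offset_eq[OF P z(2)] by simp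
    moreover have "(P, ?Q) \<in> collinear"
      unfolding collinear_iff using P Q z(2) z0 k(1)
      by (intro conjI exI[of _ "z * k"]) simp_all
    ultimately show "s \<in> offset P ` (collinear `` {P})" by (metis Image_singleton_iff imageI)
  qed
qed

text \<open>Each ot-point consists of \<open>card Z\<close> vectors, which reduces counting ot-points to counting
  vectors.\<close>

lemma card_ot_points_rep:
  assumes "0 \<notin> V" "\<And>z v. z \<in> Z \<Longrightarrow> v \<in> V \<Longrightarrow> z *s v \<in> V"
  shows "card Z * card {X \<in> ot_points Z. rep X \<in> V} = card V"
proof -
  let ?C = "{X \<in> ot_points Z. rep X \<in> V}"
  have "\<Union>?C = V"
  proof (intro equalityI subsetI)
    fix v assume "v \<in> \<Union>?C"
    then obtain X where X: "X \<in> ot_points Z" "rep X \<in> V" "v \<in> X" by blast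
    then obtain z where "z \<in> Z" "v = z *s rep X" using ot_point_eq_orbit[OF X(1)] by blast
    then show "v \<in> V" using X(2) assms(2) by simp
  next
    fix v assume v: "v \<in> V"
    let ?X = "(\<lambda>c. c *s v) ` Z"
    have X: "?X \<in> ot_points Z" using ot_point_of v assms(1) by metis
    have "?X \<subseteq> V" using assms(2) v by blast
    then have "rep ?X \<in> V" using rep_in[OF X] by blast
    moreover have "v \<in> ?X" using Z_facts(2) by (auto intro!: image_eqI[of _ _ 1])
    ultimately show "v \<in> \<Union>?C" using X by blast
  qed
  moreover have "card Z * card ?C = card (\<Union>?C)"
  proof (rule card_partition)
    fix X assume "X \<in> ?C"
    then have X: "X \<in> ot_points Z" by blast
    have "inj_on (\<lambda>c. c *s rep X) Z" using smult_cancel[OF rep_nonzero[OF X]] by (auto simp: inj_on_def)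
    then show "card X = card Z" by (subst ot_point_eq_orbit[OF X]) (rule card_image)
  next
    fix X Y assume "X \<in> ?C" "Y \<in> ?C" "X \<noteq> Y"
    then show "X \<inter> Y = {}" using ot_point_eqI by blast
  qed auto
  ultimately show ?thesis by simp
qed

lemma Z_nonempty: "Z \<noteq> {}"
  using Z_facts(2) by blast

lemma card_ot_points: "card Z * card (ot_points Z) = CARD('a)\<^sup>2 - 1"
proof -
  have "{X \<in> ot_points Z. rep X \<in> UNIV - {0}} = ot_points Z" using rep_nonzero by auto
  moreover have "card (UNIV - {0 :: 'a^2}) = CARD('a)\<^sup>2 - 1" by simp
  ultimately show ?thesis
    using card_ot_points_rep[of "UNIV - {0}"] Z_facts(1)
    by (metis DiffE DiffI UNIV_I singletonD singletonI smult_eq_0_iff)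
qed

lemma label_mult_Z: "z \<in> Z \<Longrightarrow> label (z * x) = label x"
  using label_mult[of z x] shift_eq_0_iff[of z] Z_facts(1) by (cases "x = 0") auto

text \<open>The last two counts come from the coordinates of \<open>card_pdet\<close>: one coordinate in a given
  coset and the other arbitrary, or both in given cosets.\<close>

sublocale ternary_cover "ot_points Z" collinear "\<lambda>P Q. label (rdet P Q)" offset "card Z" "CARD('a)"
proof
  show "equiv (ot_points Z) collinear" by (rule equiv_collinear)
  have "axis 1 1 \<noteq> (0 :: 'a^2)" by (simp add: axis_eq_0_iff)
  then show "ot_points Z \<noteq> {}" using ot_point_of by blast
  have "card {0, 1 :: 'a} \<le> CARD('a)" by (intro card_mono) auto
  then show "2 \<le> CARD('a)" by simp
next
  fix P Q assume "P \<in> ot_points Z" "Q \<in> ot_points Z"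
  show "label (rdet P Q) = label (rdet Q P)"
    using label_minus pdet_swap by (metis rdet_def)
next
  fix P Q X assume PQ: "(P, Q) \<in> collinear" and X: "X \<in> ot_points Z" "(P, X) \<notin> collinear"
  obtain k where k: "k \<noteq> 0" "rep Q = k *s rep P" and P: "P \<in> ot_points Z"
    using PQ by (auto simp: collinear_iff)
  have "rdet P X \<noteq> 0" using X P by (simp add: collinear_def)
  then show "label (rdet Q X) = label (rdet P X) + offset P Q"
    using label_mult k by (simp add: rdet_def pdet_scale offset_eq[OF P k(2)])
next
  fix P assume "P \<in> ot_points Z"
  then show "bij_betw (offset P) (collinear `` {P}) UNIV" by (rule offset_bij)
next
  fix P h assume P: "P \<in> ot_points Z"
  let ?A = "{x. x \<noteq> 0 \<and> label x = h}"
  let ?V = "{x. pdet (rep P) x \<in> ?A}"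
  obtain r where r: "pdet (rep P) r = 1" using exists_det_eq[OF rep_nonzero[OF P]] unfolding pdet_def by blast
  have "{X \<in> ot_points Z. rep X \<in> ?V} = {X \<in> ot_points Z. (P, X) \<notin> collinear \<and> label (rdet P X) = h}"
    using P by (auto simp: collinear_def rdet_def)
  moreover have "card Z * card {X \<in> ot_points Z. rep X \<in> ?V} = card ?V"
    using Z_facts(1) by (intro card_ot_points_rep) (auto simp: pdet_scale pdet_0 label_mult_Z)
  moreover have "card ?V = card Z * CARD('a)"
    using card_pdet[of "rep P" r ?A UNIV] r card_label by simp
  ultimately show "card {X \<in> ot_points Z. (P, X) \<notin> collinear \<and> label (rdet P X) = h} = CARD('a)"
    using Z_nonempty by simp
next
  fix P Q h k assume P: "P \<in> ot_points Z" and Q: "Q \<in> ot_points Z" and PQ: "(P, Q) \<notin> collinear"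
  let ?A = "{x. x \<noteq> 0 \<and> label x = h}" and ?B = "{x. x \<noteq> 0 \<and> label x = k}"
  let ?V = "{x. pdet (rep P) x \<in> ?A \<and> pdet x (rep Q) \<in> ?B}"
  have "{X \<in> ot_points Z. rep X \<in> ?V} = {X \<in> ot_points Z. (P, X) \<notin> collinear \<and> (X, Q) \<notin> collinear \<and>
      label (rdet P X) = h \<and> label (rdet X Q) = k}" (is "_ = ?S")
    using P Q by (auto simp: collinear_def rdet_def)
  moreover have "card Z * card {X \<in> ot_points Z. rep X \<in> ?V} = card ?V"
    using Z_facts(1) by (intro card_ot_points_rep) (auto simp: pdet_scale pdet_0 label_mult_Z)
  moreover have "card ?V = card Z * card Z"
    using card_pdet[of "rep P" "rep Q" ?A ?B] PQ P Q card_label by (simp add: collinear_def rdet_def)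
  ultimately show "card ?S = card Z" using Z_nonempty by simp
qed

end


section \<open>The switched scheme of ot-points\<close>

theorem theorem17p6:
  fixes q n :: nat
    and Z :: "'a::{field,finite} set"
    and R D :: "nat \<Rightarrow> (('a^2) set \<times> ('a^2) set) set"
    and island :: "('a^2) set set"
  assumes "primepow q" and "q mod 3 = 1" and "n = 3 * (q + 1)"
    and "CARD('a) = q"
    and "mult_subgroup Z" and "card Z = (q - 1) div 3"
    and "ot_labelling Z R D"
    and "island \<in> ot_points Z // (R 0 \<union> R 1 \<union> R 2)"
  shows "proper_jordan_scheme (ot_points Z) (switching_0 (ot_points Z) R D island)
         \<and> card (ot_points Z) = n"
proof
  obtain K where K: "bij_betw K {0, 1, 2::nat} (mult_cosets Z)" "K 0 = Z"
      "\<forall>i\<in>{0, 1, 2}. R i = ot_R Z (K i)"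
    using assms(7) unfolding ot_labelling_def by blast
  obtain C where CD: "bij_betw C {0, 1, 2::nat} (mult_cosets Z)"
      "\<forall>i\<in>{0, 1, 2}. D i = ot_Delta Z (C i)"
    using assms(7) unfolding ot_labelling_def by blast
  interpret labelled_cosets Z C using assms(5) CD(1) by unfold_locales
  \<comment> \<open>The cosets that define the relations \<open>R\<close> may be labelled differently.\<close>
  interpret K: labelled_cosets Z K using assms(5) K(1) by unfold_locales
  let ?\<Omega> = "ot_points Z"
  have R_iff: "(P, Q) \<in> R i \<longleftrightarrow> P \<in> ?\<Omega> \<and> Q \<in> ?\<Omega> \<and> (\<exists>k\<in>K i. rep Q = k *s rep P)"
    if "i \<in> {0, 1, 2}" for P Q i
  proof (cases "P \<in> ?\<Omega> \<and> Q \<in> ?\<Omega>")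
    case True
    then show ?thesis using ot_R_iff[OF _ _ K.C_cosets[OF that]] bspec[OF K(3) that] by simp
  next
    case False
    then show ?thesis using bspec[OF K(3) that] by (auto simp: ot_R_def)
  qed
  have K_Un: "k \<in> K 0 \<union> K 1 \<union> K 2 \<longleftrightarrow> k \<noteq> 0" for k
    using K.ex_C[of k] mult_coset_eq(1)[OF Z K.C_cosets] by auto
  have E: "R 0 \<union> R 1 \<union> R 2 = collinear"
  proof -
    have "(P, Q) \<in> R 0 \<union> R 1 \<union> R 2 \<longleftrightarrow> (P, Q) \<in> collinear" for P Q
      unfolding collinear_iff K_Un[symmetric] using R_iff[of _ P Q] by auto
    then show ?thesis by auto
  qed
  interpret switched_cover ?\<Omega> collinear "\<lambda>P Q. label (rdet P Q)" offset "card Z" "CARD('a)" island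
    using assms(8) unfolding E by unfold_locales
  have R0: "R 0 = Id_on ?\<Omega>"
  proof -
    have eq_iff: "(P, Q) \<in> R 0 \<longleftrightarrow> P = Q" if "P \<in> ?\<Omega>" "Q \<in> ?\<Omega>" for P Q
    proof -
      have "(P, Q) \<in> R 0 \<longleftrightarrow> rep Q \<in> P"
        using R_iff[of 0 P Q] that ot_point_eq_orbit[OF that(1)] K(2) by auto
      then show ?thesis using that ot_point_eqI rep_in by metis
    qed
    have "(P, Q) \<in> R 0 \<longleftrightarrow> (P, Q) \<in> Id_on ?\<Omega>" for P Q
    proof (cases "P \<in> ?\<Omega> \<and> Q \<in> ?\<Omega>")
      case True
      then show ?thesis using eq_iff[of P Q] by (auto simp: Id_on_iff)
    next
      case False
      then show ?thesis using R_iff[of 0 P Q] by (auto simp: Id_on_iff)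
    qed
    then show ?thesis by auto
  qed
  have R12: "R 1 \<union> R 2 = collinear - Id_on ?\<Omega>"
  proof -
    have not_R0: "(P, Q) \<notin> R 0" if PQ: "(P, Q) \<in> R i" and i12: "i \<in> {1, 2}" for P Q i
    proof
      have i: "0 \<in> {0, 1, 2::nat}" "i \<in> {0, 1, 2}" using i12 by blast+
      assume "(P, Q) \<in> R 0"
      then obtain k where k: "k \<in> K 0" "rep Q = k *s rep P" and P: "P \<in> ?\<Omega>"
        using iffD1[OF R_iff[OF i(1)]] by metis
      obtain m where m: "m \<in> K i" "rep Q = m *s rep P"
        using iffD1[OF R_iff[OF i(2)] PQ] by metis
      have "k = m" using smult_cancel[OF rep_nonzero[OF P], of k m] k(2) m(2) by metis
      then have "k \<in> K 0" "k \<in> K i" using k(1) m(1) by simp_all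
      then show False using K.C_disjoint[OF _ _ i] i12 by auto
    qed
    have "x \<notin> R 0" if "x \<in> R 1 \<union> R 2" for x
      using that not_R0[of "fst x" "snd x" 1] not_R0[of "fst x" "snd x" 2] by auto
    then show ?thesis unfolding R0[symmetric] E[symmetric] by blast
  qed
  have D_iff: "(P, Q) \<in> D i \<longleftrightarrow> P \<in> ?\<Omega> \<and> Q \<in> ?\<Omega> \<and> (P, Q) \<notin> collinear \<and> label (rdet P Q) = of_nat i"
    if "i \<in> {0, 1, 2}" for P Q i
  proof (cases "P \<in> ?\<Omega> \<and> Q \<in> ?\<Omega>")
    case True
    then have "(P, Q) \<in> D i \<longleftrightarrow> rdet P Q \<in> C i"
      using ot_Delta_iff[OF _ _ C_cosets[OF that]] bspec[OF CD(2) that] by simp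
    also have "\<dots> \<longleftrightarrow> rdet P Q \<noteq> 0 \<and> label (rdet P Q) = of_nat i"
      using mem_C_iff[OF _ that, of "rdet P Q"]
        mult_coset_eq(1)[OF Z C_cosets[OF that], of "rdet P Q"] by metis
    finally show ?thesis using True by (auto simp: collinear_def)
  next
    case False
    then show ?thesis using bspec[OF CD(2) that] by (auto simp: ot_Delta_def)
  qed
  have B: "switched_rel h = continent_part ?\<Omega> island (D i) \<union> bridge_part ?\<Omega> island (D j)"
    if "i \<in> {0, 1, 2}" "j \<in> {0, 1, 2}" "h = of_nat i" "- h = of_nat j" for h i j
  proof -
    have neg: "- x = h \<longleftrightarrow> x = - h" for x by (metis minus_minus)
    have "(P, Q) \<in> switched_rel h \<longleftrightarrow> (P, Q) \<in> continent_part ?\<Omega> island (D i) \<union> bridge_part ?\<Omega> island (D j)" for P Q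
    proof (cases "P \<in> ?\<Omega> \<and> Q \<in> ?\<Omega> \<and> (P, Q) \<notin> collinear")
      case True
      have D: "(P, Q) \<in> D i \<longleftrightarrow> label (rdet P Q) = h" "(P, Q) \<in> D j \<longleftrightarrow> label (rdet P Q) = - h"
        using True D_iff[OF that(1), of P Q] D_iff[OF that(2), of P Q] that(3,4) by simp_all
      \<comment> \<open>The island is a single fiber.\<close>
      have "\<not> (P \<in> island \<and> Q \<in> island)" using True island_eq by blast
      then show ?thesis
        using True D neg
        by (cases "P \<in> island"; cases "Q \<in> island")
          (simp_all add: switched_rel_def switched_col_def continent_part_def bridge_part_def)
    next
      case False
      then show ?thesis
        using D_iff[OF that(1), of P Q] D_iff[OF that(2), of P Q]
        by (auto simp: switched_rel_def continent_part_def bridge_part_def)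
    qed
    then show ?thesis by auto
  qed
  have "switching_0 ?\<Omega> R D island = switched_relations"
    using B[of 0 0 0] B[of 1 2 1] B[of 2 1 2] R12
    by (simp add: switching_0_def switched_relations_def)
  then show "proper_jordan_scheme ?\<Omega> (switching_0 ?\<Omega> R D island)"
    using proper_switched_relations by simp
  have "q = 3 * ((q - 1) div 3) + 1" using assms(2) by presburger
  then have l: "q = 3 * card Z + 1" using assms(6) by simp
  have "card Z * card ?\<Omega> = card Z * n"
    using card_ot_points unfolding assms(3,4) l by (simp add: power2_eq_square algebra_simps)
  then show "card ?\<Omega> = n" using Z_nonempty by simp
qed

end
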